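(* Let $(W,S)$ be an irreducible Coxeter system with $S$ finite. In each of the following cases, the canonical automaton $\mathcal A_0(W,S)$ is minimal if and only if $\Sigma=\Phi^+_{sph}$: (1) $W$ is finite; (2) $W$ is right-angled, i.e. $m_{st}\in\{2,\infty\}$ for all $s\neq t$; (3) the Coxeter graph is complete, i.e. $m_{st}>2$ for all $s\neq t$; (4) $W$ is of type $\widetilde{A}_{n-1}$ (Coxeter graph a cycle with all edge labels $3$); (5) $|S|=3$. Moreover, in cases (1)–(4) one has $\Sigma=\Phi^+_{sph}$ and $\mathcal A_0(W,S)$ is minimal.
   Context: $m_{st}$ is the order of $st$. Fix a geometric representation of $(W,S)$: a real vector space $V$ with symmetric bilinear form $B$ and a basis $\Delta=\{\alpha_s\}_{s\in S}$ with $B(\alpha_s,\alpha_s)=1$, $B(\alpha_s,\alpha_t)=-\cos(\pi/m_{st})$ if $m_{st}<\infty$ and $B(\alpha_s,\alpha_t)\le -1$ if $m_{st}=\infty$, where $s$ acts by $s(v)=v-2B(\alpha_s,v)\alpha_s$. The root system is $\Phi=W(\Delta)$, positive roots $\Phi^+=\Phi\cap\operatorname{cone}(\Delta)$ (nonnegative combinations), $\Phi^-=-\Phi^+$. The left inversion set of $w$ is $N(w)=\Phi^+\cap w(\Phi^-)$. The dominance order on $\Phi^+$: $\alpha\preceq\beta$ iff for all $w\in W$, $\beta\in N(w)$ implies $\alpha\in N(w)$. A positive root is small if it strictly dominates no positive root; $\Sigma$ is the (finite) set of small roots, $\Sigma(w)=N(w)\cap\Sigma$ and $\Lambda_0=\{\Sigma(w)\mid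 w\in W\}$. The support of $\beta=\sum a_s\alpha_s\in\Phi^+$ is $\{s\mid a_s>0\}$; $\Phi^+_{sph}$ is the set of positive roots whose support generates a finite standard parabolic subgroup. The canonical automaton $\mathcal A_0(W,S)$ over $S$ has state set $\Lambda_0$, initial state $\emptyset$, all states final, and transitions $A\overset{s}{\rightarrow}\{\alpha_s\}\cup(s(A)\cap\Sigma)$ whenever $\alpha_s\notin A$; it recognizes the language of reduced words of $(W,S)$. An automaton all of whose states are reachable from the initial state is minimal if no two distinct states are equivalent, where states $q,q'$ are equivalent if the set of words that can be read (along a path ending at a final state) starting from $q$ equals that starting from $q'$; equivalently it is the minimal automaton of its language. *)

theory Defs
  imports
    "HOL-Analysis.Linear_Algebra"
    "HOL-Algebra.Group_Action"
    "HOL-Algebra.Multiplicative_Group"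
begin

section \<open>Coxeter systems\<close>

definition word_prod :: "('g, 'b) monoid_scheme \<Rightarrow> 'g list \<Rightarrow> 'g" where
  "word_prod G w = foldr (\<lambda>x y. x \<otimes>\<^bsub>G\<^esub> y) w \<one>\<^bsub>G\<^esub>"

text \<open>
  The relators of the Coxeter presentation are the words \<open>(st)\<^sup>m\<close>, where \<open>m\<close> is the order of
  \<open>st\<close>. As \<^const>\<open>group.ord\<close> is \<open>0\<close> for elements of infinite order, the relator is then the empty
  word, i.e. there is no relation. For generators \<open>s = t\<close> of order two, \<open>m\<close> is \<open>1\<close> and the
  relator is \<open>ss\<close>; in the presence of these relators every generator is its own formal inverse,
  so words over \<open>S\<close> suffice to describe the group with these generators and relators.
\<close>

definition coxeter_relators :: "('g, 'b) monoid_scheme \<Rightarrow> 'g set \<Rightarrow> 'g list set" where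
  "coxeter_relators G S =
    {concat (replicate (group.ord G (s \<otimes>\<^bsub>G\<^esub> t)) [s, t]) | s t. s \<in> S \<and> t \<in> S}"

definition relator_deletion :: "('g, 'b) monoid_scheme \<Rightarrow> 'g set \<Rightarrow> ('g list \<times> 'g list) set" where
  "relator_deletion G S =
    {(u @ r @ v, u @ v) | u r v. u \<in> lists S \<and> v \<in> lists S \<and> r \<in> coxeter_relators G S}"

text \<open>
  \<open>S\<close> is a set of generators of order two, and \<open>G\<close> is presented by \<open>S\<close> and the Coxeter
  relators: a word that is trivial in \<open>G\<close> can be turned into the empty word by inserting and
  deleting relators.
\<close>

locale coxeter_system = group G for G :: "('g, 'b) monoid_scheme" (structure) +
  fixes S :: "'g set"
  assumes generators_subset: "S \<subseteq> carrier G"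
    and generators_generate: "generate G S = carrier G"
    and generators_order: "\<And>s. s \<in> S \<Longrightarrow> ord s = 2"
    and presentation: "\<And>w. w \<in> lists S \<Longrightarrow> word_prod G w = \<one> \<Longrightarrow>
      (w, []) \<in> (relator_deletion G S \<union> (relator_deletion G S)\<inverse>)\<^sup>*"
begin

text \<open>The value \<open>0\<close> encodes \<open>m\<^sub>s\<^sub>t = \<infinity>\<close>.\<close>

definition m :: "'g \<Rightarrow> 'g \<Rightarrow> nat" where
  "m s t = ord (s \<otimes> t)"

definition coxeter_graph :: "('g \<times> 'g) set" where
  "coxeter_graph = {(s, t). s \<in> S \<and> t \<in> S \<and> s \<noteq> t \<and> (m s t = 0 \<or> m s t \<ge> 3)}"

definition irreducible_system :: bool where
  "irreducible_system \<longleftrightarrow> S \<noteq> {} \<and> (\<forall>s\<in>S. \<forall>t\<in>S. (s, t) \<in> coxeter_graph\<^sup>*)"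

definition right_angled :: bool where
  "right_angled \<longleftrightarrow> (\<forall>s\<in>S. \<forall>t\<in>S. s \<noteq> t \<longrightarrow> m s t = 2 \<or> m s t = 0)"

definition complete_coxeter_graph :: bool where
  "complete_coxeter_graph \<longleftrightarrow> (\<forall>s\<in>S. \<forall>t\<in>S. s \<noteq> t \<longrightarrow> m s t = 0 \<or> m s t > 2)"

text \<open>The Coxeter graph is a cycle on \<open>n \<ge> 3\<close> vertices with all labels equal to \<open>3\<close>.\<close>

definition affine_type_A :: bool where
  "affine_type_A \<longleftrightarrow>
    (\<exists>n f. n \<ge> 3 \<and> bij_betw f {..<n} S \<and>
      (\<forall>i<n. \<forall>j<n. i \<noteq> j \<longrightarrow>
        m (f i) (f j) = (if j = Suc i mod n \<or> i = Suc j mod n then 3 else 2)))"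

end


section \<open>Geometric representations and small roots\<close>

locale geometric_representation = coxeter_system G S
  for G :: "('g, 'b) monoid_scheme" (structure) and S +
  fixes B :: "'v::real_vector \<Rightarrow> 'v \<Rightarrow> real"
    and \<alpha> :: "'g \<Rightarrow> 'v"
    and act :: "'g \<Rightarrow> 'v \<Rightarrow> 'v"
  assumes form_bilinear: "bilinear B"
    and form_sym: "\<And>u v. B u v = B v u"
    and simple_roots_inj: "inj_on \<alpha> S"
    and simple_roots_independent: "independent (\<alpha> ` S)"
    and simple_roots_span: "span (\<alpha> ` S) = UNIV"
    and form_diag: "\<And>s. s \<in> S \<Longrightarrow> B (\<alpha> s) (\<alpha> s) = 1"
    and form_finite: "\<And>s t. s \<in> S \<Longrightarrow> t \<in> S \<Longrightarrow> s \<noteq> t \<Longrightarrow> m s t \<noteq> 0 \<Longrightarrow>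
      B (\<alpha> s) (\<alpha> t) = - cos (pi / real (m s t))"
    and form_infinite: "\<And>s t. s \<in> S \<Longrightarrow> t \<in> S \<Longrightarrow> s \<noteq> t \<Longrightarrow> m s t = 0 \<Longrightarrow>
      B (\<alpha> s) (\<alpha> t) \<le> - 1"
    and action: "group_action G UNIV act"
    and act_generator: "\<And>s v. s \<in> S \<Longrightarrow> act s v = v - (2 * B (\<alpha> s) v) *\<^sub>R \<alpha> s"
begin

definition roots :: "'v set" where
  "roots = {act w (\<alpha> s) | w s. w \<in> carrier G \<and> s \<in> S}"

definition simple_cone :: "'v set" where
  "simple_cone = {\<Sum>s\<in>F. c s *\<^sub>R \<alpha> s | F c. finite F \<and> F \<subseteq> S \<and> (\<forall>s\<in>F. (c s :: real) \<ge> 0)}"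

definition pos_roots :: "'v set" where
  "pos_roots = roots \<inter> simple_cone"

definition neg_roots :: "'v set" where
  "neg_roots = uminus ` pos_roots"

definition inversions :: "'g \<Rightarrow> 'v set" where
  "inversions w = pos_roots \<inter> act w ` neg_roots"

definition dominated_by :: "'v \<Rightarrow> 'v \<Rightarrow> bool" where
  "dominated_by a b \<longleftrightarrow> (\<forall>w\<in>carrier G. b \<in> inversions w \<longrightarrow> a \<in> inversions w)"

definition small_roots :: "'v set" where
  "small_roots = {b \<in> pos_roots. \<not> (\<exists>a\<in>pos_roots. a \<noteq> b \<and> dominated_by a b)}"

definition small_inversions :: "'g \<Rightarrow> 'v set" where
  "small_inversions w = inversions w \<inter> small_roots"

definition small_inversion_sets :: "'v set set" where
  "small_inversion_sets = small_inversions ` carrier G"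

definition support :: "'v \<Rightarrow> 'g set" where
  "support b = {s \<in> S. representation (\<alpha> ` S) b (\<alpha> s) > 0}"

definition spherical_roots :: "'v set" where
  "spherical_roots = {b \<in> pos_roots. finite (generate G (support b))}"

end


section \<open>Automata\<close>

text \<open>Deterministic, possibly partial, automata: a transition need not exist for every letter.\<close>

record ('q, 'a) automaton =
  states :: "'q set"
  initial :: 'q
  final :: "'q set"
  transitions :: "('q \<times> 'a \<times> 'q) set"

fun reads :: "('q, 'a) automaton \<Rightarrow> 'q \<Rightarrow> 'a list \<Rightarrow> 'q \<Rightarrow> bool" where
  "reads \<A> q [] q' \<longleftrightarrow> q' = q"
| "reads \<A> q (a # w) q' \<longleftrightarrow> (\<exists>p. (q, a, p) \<in> transitions \<A> \<and> reads \<A> p w q')"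

definition lang_from :: "('q, 'a) automaton \<Rightarrow> 'q \<Rightarrow> 'a list set" where
  "lang_from \<A> q = {w. \<exists>q'\<in>final \<A>. reads \<A> q w q'}"

definition minimal_automaton :: "('q, 'a) automaton \<Rightarrow> bool" where
  "minimal_automaton \<A> \<longleftrightarrow>
    (\<forall>q\<in>states \<A>. \<exists>w. reads \<A> (initial \<A>) w q) \<and>
    (\<forall>q\<in>states \<A>. \<forall>q'\<in>states \<A>. lang_from \<A> q = lang_from \<A> q' \<longrightarrow> q = q')"

definition (in geometric_representation) canonical_automaton :: "('v set, 'g) automaton" where
  "canonical_automaton =
    \<lparr>states = small_inversion_sets,
     initial = {},
     final = small_inversion_sets,
     transitions = {(A, s, {\<alpha> s} \<union> (act s ` A \<inter> small_roots)) | A s.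
       A \<in> small_inversion_sets \<and> s \<in> S \<and> \<alpha> s \<notin> A}\<rparr>"

end

(*
  By the classical theorem, w maps the simple root alpha_s to a positive root iff l(ws) > l(w);
  everything else only involves the inversion sets N(w). A word representing x can be read from
  the state of u iff it is reduced and N(x) and N(u) are disjoint.

  If W_I is finite and b is a positive root of W_I outside N(w), some x in W_I has b in N(x) and
  N(x) disjoint from N(w). Hence spherical roots are small, and states that differ in a spherical
  root are not equivalent; so the automaton is minimal as soon as all small roots are spherical.

  Small roots grow from simple ones by reflections in alpha_s with -1 < B(alpha_s, c) < 0, since
  s(c) dominates alpha_s when B(alpha_s, c) <= -1. With coordinates being 0 or at least 1, this
  keeps small roots in finite dihedral subgroups (cases 2 and 3, and rank 3 with an infinite
  label), or in proper arcs of the cycle (type affine A). In the remaining case of rank 3, with s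
  and u commuting, finite labels and W infinite, the states of su and sut are equivalent but
  distinct.
*)

theory Submission
  imports Defs
begin

text \<open>That the relators present the group is used through parity alone: they have even length,
  so l(ws) never equals l(w). No exchange condition is proved; positivity of w(alpha_s) at an ascent
  s comes from an induction that splits off the dihedral subgroup of s and a descent. The bound -1
  has two sources. From -1 on, repeated reflections produce an endless chain of positive roots, and
  an element that inverts s(c) but not alpha_s would invert the whole chain, although N(w) is
  finite. The same bound is reached as soon as a new generator meets a root at two neighbours:
  coordinates at least 1 times form values at most -1/2 add up to -1. Hence on a complete graph a
  root of rank two cannot grow to rank three, and on a cycle an arc cannot be closed up. In the
  failing case of rank three the states of su and sut differ in b = su(alpha_t). Its support is all
  of S, so it is not spherical. It is small, because it dominates neither alpha_s nor alpha_u; but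
  no word detects it, because an element that inverts b also inverts alpha_s or alpha_u.\<close>

context coxeter_system
begin

section \<open>Words in the generators and the subgroups they generate\<close>

lemma generator_closed [simp, intro]: "s \<in> S \<Longrightarrow> s \<in> carrier G"
  using generators_subset by blast

lemma generator_square: "s \<in> S \<Longrightarrow> s \<otimes> s = \<one>"
  using pow_ord_eq_1[of s] generators_order[of s] by (simp add: numeral_2_eq_2)

lemma generator_cancel: "s \<in> S \<Longrightarrow> w \<in> carrier G \<Longrightarrow> s \<otimes> (s \<otimes> w) = w"
  by (simp add: generator_square flip: m_assoc)

lemma generator_cancel_right: "s \<in> S \<Longrightarrow> w \<in> carrier G \<Longrightarrow> w \<otimes> s \<otimes> s = w"
  by (simp add: generator_square m_assoc)

lemma generator_inv: "s \<in> S \<Longrightarrow> inv s = s"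
  by (simp add: generator_square inv_equality)

lemma m_sym: "s \<in> S \<Longrightarrow> t \<in> S \<Longrightarrow> m s t = m t s"
  unfolding m_def by (metis generator_closed generator_inv inv_mult_group m_closed ord_inv)

lemma m_eq_1_iff: "s \<in> S \<Longrightarrow> t \<in> S \<Longrightarrow> m s t = 1 \<longleftrightarrow> s = t"
  unfolding m_def
  by (metis generator_closed generator_inv generator_square inv_equality m_closed One_nat_def ord_eq_1)

lemma m_ge_2: "s \<in> S \<Longrightarrow> t \<in> S \<Longrightarrow> s \<noteq> t \<Longrightarrow> m s t \<noteq> 0 \<Longrightarrow> 2 \<le> m s t"
  using m_eq_1_iff[of s t] by linarith

lemma word_prod_Nil [simp]: "word_prod G [] = \<one>"
  by (simp add: word_prod_def)

lemma word_prod_Cons [simp]: "word_prod G (s # xs) = s \<otimes> word_prod G xs"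
  by (simp add: word_prod_def)

lemma word_prod_closed [simp]: "xs \<in> lists S \<Longrightarrow> word_prod G xs \<in> carrier G"
  by (induction xs) auto

lemma word_prod_append:
  "xs \<in> lists S \<Longrightarrow> ys \<in> lists S \<Longrightarrow> word_prod G (xs @ ys) = word_prod G xs \<otimes> word_prod G ys"
  by (induction xs) (auto simp: m_assoc)

lemma inv_word_prod: "xs \<in> lists S \<Longrightarrow> inv (word_prod G xs) = word_prod G (rev xs)"
proof (induction xs)
  case (Cons s xs)
  then show ?case
    by (simp add: in_lists_conv_set word_prod_append inv_mult_group generator_inv)
qed auto

lemma generate_eq_words:
  assumes "I \<subseteq> S"
  shows "generate G I = word_prod G ` lists I"
proof
  show "generate G I \<subseteq> word_prod G ` lists I"
  proof
    fix w assume "w \<in> generate G I"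
    then show "w \<in> word_prod G ` lists I"
    proof (induction rule: generate.induct)
      case one
      show ?case by (rule image_eqI[of _ _ "[]"]) auto
    next
      case (incl h)
      then show ?case using assms by (intro image_eqI[of _ _ "[h]"]) auto
    next
      case (inv h)
      then show ?case using assms by (intro image_eqI[of _ _ "[h]"]) (auto simp: generator_inv subsetD)
    next
      case (eng h1 h2)
      then obtain xs ys where "xs \<in> lists I" "ys \<in> lists I" "h1 = word_prod G xs" "h2 = word_prod G ys"
        by blast
      moreover have "lists I \<subseteq> lists S" using assms by (rule lists_mono)
      ultimately show ?case
        by (intro image_eqI[of _ _ "xs @ ys"]) (auto simp: word_prod_append subsetD)
    qed
  qed
  show "word_prod G ` lists I \<subseteq> generate G I"
  proof
    fix w assume "w \<in> word_prod G ` lists I"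
    then obtain xs where "xs \<in> lists I" "w = word_prod G xs" by blast
    then show "w \<in> generate G I"
      by (induction xs arbitrary: w) (auto intro: generate.intros)
  qed
qed

lemma carrier_eq_words: "carrier G = word_prod G ` lists S"
  using generate_eq_words[of S] generators_generate by simp

lemma word_exists:
  assumes "w \<in> carrier G"
  obtains xs where "xs \<in> lists S" "word_prod G xs = w"
  using assms carrier_eq_words by auto

lemma generate_closed: "I \<subseteq> S \<Longrightarrow> w \<in> generate G I \<Longrightarrow> w \<in> carrier G"
  by (meson generate_in_carrier generators_subset order_trans)

lemma generate_word_induct [consumes 2, case_names one mult]:
  assumes "w \<in> generate G I" "I \<subseteq> S"
    and "P \<one>"
    and "\<And>s w. s \<in> I \<Longrightarrow> w \<in> generate G I \<Longrightarrow> P w \<Longrightarrow> P (s \<otimes> w)"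
  shows "P w"
proof -
  obtain xs where "xs \<in> lists I" "w = word_prod G xs"
    using assms(1) generate_eq_words[OF assms(2)] by blast
  then show ?thesis
  proof (induction xs arbitrary: w)
    case Nil
    then show ?case using assms(3) by simp
  next
    case (Cons s xs)
    then have "word_prod G xs \<in> generate G I"
      using generate_eq_words[OF assms(2)] by auto
    then show ?case using Cons assms(4) by auto
  qed
qed

lemmas carrier_induct [consumes 1, case_names one mult] =
  generate_word_induct[where I = S, unfolded generators_generate, OF _ order_refl]

section \<open>Length and its parity\<close>

lemma even_length_relator: "r \<in> coxeter_relators G S \<Longrightarrow> even (length r)"
  by (auto simp: coxeter_relators_def length_concat sum_list_replicate)

text \<open>Inserting or deleting a relator preserves the parity of the length. This well-defined
  sign is all that is extracted from \<open>presentation\<close>.\<close>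

lemma even_length_trivial_word:
  assumes "xs \<in> lists S" "word_prod G xs = \<one>"
  shows "even (length xs)"
proof -
  have "(xs, []) \<in> (relator_deletion G S \<union> (relator_deletion G S)\<inverse>)\<^sup>*"
    using presentation assms by blast
  then show ?thesis
    by (induction rule: converse_rtrancl_induct)
       (auto simp: relator_deletion_def dest: even_length_relator)
qed

definition len :: "'g \<Rightarrow> nat" where
  "len w = (LEAST k. \<exists>xs\<in>lists S. length xs = k \<and> word_prod G xs = w)"

lemma len_le: "xs \<in> lists S \<Longrightarrow> len (word_prod G xs) \<le> length xs"
  unfolding len_def by (rule Least_le) auto

lemma reduced_word_exists:
  assumes "w \<in> carrier G"
  obtains xs where "xs \<in> lists S" "word_prod G xs = w" "length xs = len w"
proof -
  have "\<exists>k. \<exists>xs\<in>lists S. length xs = k \<and> word_prod G xs = w"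
    using word_exists[OF assms] by metis
  from LeastI_ex[OF this] that show thesis
    unfolding len_def by blast
qed

lemma len_mult_le:
  assumes "v \<in> carrier G" "w \<in> carrier G"
  shows "len (v \<otimes> w) \<le> len v + len w"
proof -
  obtain xs ys where "xs \<in> lists S" "word_prod G xs = v" "length xs = len v"
    "ys \<in> lists S" "word_prod G ys = w" "length ys = len w"
    using reduced_word_exists assms by metis
  then show ?thesis
    using len_le[of "xs @ ys"] word_prod_append[of xs ys] by auto
qed

lemma len_generator: "s \<in> S \<Longrightarrow> len s \<le> 1"
  using len_le[of "[s]"] by simp

text \<open>The triangle inequality bounds the change by one. Reduced words of w, of s and of the
  inverse of ws concatenate to a trivial word, so parity rules out equal lengths.\<close>

lemma len_mult_generator:
  assumes "w \<in> carrier G" "s \<in> S"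
  shows "len (w \<otimes> s) = Suc (len w) \<or> len w = Suc (len (w \<otimes> s))"
proof -
  obtain xs where xs: "xs \<in> lists S" "word_prod G xs = w" "length xs = len w"
    using reduced_word_exists assms by metis
  obtain ys where ys: "ys \<in> lists S" "word_prod G ys = w \<otimes> s" "length ys = len (w \<otimes> s)"
    using reduced_word_exists[of "w \<otimes> s"] assms by auto
  have "word_prod G ((xs @ [s]) @ rev ys) = (w \<otimes> s) \<otimes> inv (w \<otimes> s)"
    using xs ys assms by (subst word_prod_append) (auto simp: word_prod_append simp flip: inv_word_prod)
  then have "even (length ((xs @ [s]) @ rev ys))"
    using assms xs ys by (intro even_length_trivial_word) auto
  then have "even (Suc (len w + len (w \<otimes> s)))"
    using xs ys by simp
  moreover have "len (w \<otimes> s) \<le> Suc (len w)"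
    using len_mult_le[of w s] len_generator[of s] assms by auto
  moreover have "len w \<le> Suc (len (w \<otimes> s))"
    using len_mult_le[of "w \<otimes> s" s] len_generator[of s] assms by (auto simp: generator_cancel_right)
  ultimately show ?thesis by presburger
qed

lemma descent_exists:
  assumes "w \<in> carrier G" "w \<noteq> \<one>"
  obtains s where "s \<in> S" "len w = Suc (len (w \<otimes> s))"
proof -
  obtain xs where xs: "xs \<in> lists S" "word_prod G xs = w" "length xs = len w"
    using reduced_word_exists assms by metis
  then have "xs \<noteq> []" using assms by auto
  then obtain ys s where ys: "xs = ys @ [s]" by (metis rev_exhaust)
  then have "w \<otimes> s = word_prod G ys"
    using xs by (auto simp: word_prod_append generator_cancel_right in_lists_conv_set)
  then have "len (w \<otimes> s) < len w"
    using len_le[of ys] ys xs by auto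
  then show thesis
    using that[of s] len_mult_generator[of w s] xs ys assms by auto
qed

section \<open>Alternating words\<close>

text \<open>The last letter is always \<open>t\<close> and the word grows on the left: the letters
  then act in turn on \<open>\<alpha> s\<close>, and a letter split off from the left factor in
  \<open>alternating_factorization\<close> can be put in front.\<close>

fun alternating :: "nat \<Rightarrow> 'g \<Rightarrow> 'g \<Rightarrow> 'g list" where
  "alternating 0 s t = []"
| "alternating (Suc k) s t = (if even k then t else s) # alternating k s t"

lemma length_alternating [simp]: "length (alternating k s t) = k"
  by (induction k) auto

lemma alternating_in_lists: "s \<in> S \<Longrightarrow> t \<in> S \<Longrightarrow> alternating k s t \<in> lists S"
  by (induction k) auto

lemma alternating_snoc: "alternating (Suc k) s t = alternating k t s @ [t]"
  by (induction k) auto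

lemma alternating_add: "\<exists>xs. set xs \<subseteq> {s, t} \<and> length xs = j \<and> alternating (j + k) s t = xs @ alternating k s t"
proof (induction j)
  case (Suc j)
  then obtain xs where "set xs \<subseteq> {s, t}" "length xs = j" "alternating (j + k) s t = xs @ alternating k s t"
    by blast
  then show ?case
    by (intro exI[of _ "(if even (j + k) then t else s) # xs"]) auto
qed auto

lemma pow_mult_shift:
  assumes "s \<in> S" "t \<in> S"
  shows "s \<otimes> (t \<otimes> s) [^] (k::nat) \<otimes> t = (s \<otimes> t) [^] Suc k"
  using assms
proof (induction k)
  case (Suc k)
  have "s \<otimes> (t \<otimes> s) [^] Suc k \<otimes> t = (s \<otimes> (t \<otimes> s) [^] k \<otimes> t) \<otimes> (s \<otimes> t)"
    using Suc.prems by (simp add: m_assoc)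
  then show ?case using Suc by simp
qed auto

text \<open>The inverse of the word ending in \<open>s\<close> begins with \<open>s\<close>, so the
  quotient is the alternating word of length 2k from \<open>s\<close> to \<open>t\<close>. At k =
  \<open>m s t\<close> it becomes trivial, which is the braid relation.\<close>

lemma alternating_quotient:
  assumes "s \<in> S" "t \<in> S"
  shows "inv (word_prod G (alternating k t s)) \<otimes> word_prod G (alternating k s t) = (s \<otimes> t) [^] k"
  using assms
proof (induction k arbitrary: s t)
  case (Suc k)
  let ?a = "word_prod G (alternating k s t)" and ?b = "word_prod G (alternating k t s)"
  have c: "?a \<in> carrier G" "?b \<in> carrier G"
    using Suc.prems by (simp_all add: alternating_in_lists)
  have "word_prod G (alternating (Suc k) s t) = ?b \<otimes> t" "word_prod G (alternating (Suc k) t s) = ?a \<otimes> s"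
    unfolding alternating_snoc using Suc.prems by (simp_all add: alternating_in_lists word_prod_append)
  then have "inv (word_prod G (alternating (Suc k) t s)) \<otimes> word_prod G (alternating (Suc k) s t)
      = s \<otimes> (inv ?a \<otimes> ?b) \<otimes> t"
    using Suc.prems c by (simp add: inv_mult_group generator_inv m_assoc)
  also have "\<dots> = (s \<otimes> t) [^] Suc k"
    using Suc.IH[of t s] Suc.prems pow_mult_shift[of s t k] by simp
  finally show ?case .
qed auto

lemma braid:
  assumes "s \<in> S" "t \<in> S"
  shows "word_prod G (alternating (m s t) s t) = word_prod G (alternating (m s t) t s)"
proof -
  let ?a = "word_prod G (alternating (m s t) s t)" and ?b = "word_prod G (alternating (m s t) t s)"
  have c: "?a \<in> carrier G" "?b \<in> carrier G"
    using assms by (simp_all add: alternating_in_lists)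
  have "inv ?b \<otimes> ?a = \<one>"
    using alternating_quotient[OF assms, of "m s t"] assms by (simp add: m_def pow_ord_eq_1)
  then show ?thesis
    using c by (metis inv_equality inv_inv inv_closed)
qed

text \<open>
  An alternating factor of maximal length splits off a left factor that is a minimal coset
  representative of the dihedral subgroup generated by \<open>s\<close> and \<open>t\<close>.
\<close>

lemma alternating_factorization:
  assumes w: "w \<in> carrier G" and s: "s \<in> S" and t: "t \<in> S"
    and up: "len w < len (w \<otimes> s)" and down: "len (w \<otimes> t) < len w"
  obtains v k where "v \<in> carrier G" "w = v \<otimes> word_prod G (alternating k s t)"
    "len v < len w" "len v < len (v \<otimes> s)" "len v < len (v \<otimes> t)"
    "m s t \<noteq> 0 \<Longrightarrow> k < m s t"
proof -
  let ?a = "\<lambda>k. word_prod G (alternating k s t)"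
  have ac: "?a k \<in> carrier G" for k
    using s t by (simp add: alternating_in_lists)
  have al: "len (?a k) \<le> k" for k
    using len_le[OF alternating_in_lists[OF s t], of k] by simp
  define P where "P k \<longleftrightarrow> (\<exists>v\<in>carrier G. w = v \<otimes> ?a k \<and> len v + k = len w)" for k
  have P1: "P 1"
    unfolding P_def using w t down len_mult_generator[OF w t]
    by (intro bexI[of _ "w \<otimes> t"]) (auto simp: generator_cancel_right)
  have bound: "\<forall>k. P k \<longrightarrow> k \<le> len w" by (auto simp: P_def)
  have P: "P (GREATEST k. P k)"
    using GreatestI_nat[of P, OF P1] bound by blast
  have ge: "j \<le> (GREATEST k. P k)" if "P j" for j
    using Greatest_le_nat[of P, OF that] bound by blast
  define k where "k = (GREATEST k. P k)"
  obtain v where v: "v \<in> carrier G" "w = v \<otimes> ?a k" "len v + k = len w"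
    using P unfolding k_def P_def by blast
  have k1: "1 \<le> k" using ge[OF P1] unfolding k_def .
  then obtain j where j: "k = Suc j" by (cases k) auto
  \<comment> \<open>A letter \<open>r\<close> that shortens \<open>v\<close> either prolongs the
    alternating factor, against maximality, or cancels its first letter, against additivity of the
    lengths.\<close>
  have *: "len v < len (v \<otimes> r)" if r: "r = s \<or> r = t" for r
  proof (rule ccontr)
    assume "\<not> len v < len (v \<otimes> r)"
    then have lr: "len v = Suc (len (v \<otimes> r))"
      using len_mult_generator[of v r] v s t r by auto
    have rS: "r \<in> S" using r s t by auto
    have wr: "w = v \<otimes> r \<otimes> (r \<otimes> ?a k)"
      using v rS ac by (simp add: m_assoc generator_cancel)
    show False
    proof (cases "r = (if even k then t else s)")
      case True
      then have "w = v \<otimes> r \<otimes> ?a (Suc k)" using wr by simp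
      then have "P (Suc k)" unfolding P_def using v lr rS by (intro bexI[of _ "v \<otimes> r"]) auto
      then show False using ge[of "Suc k"] unfolding k_def by linarith
    next
      case False
      then have "r = (if even j then t else s)" using r j by auto
      then have "r \<otimes> ?a k = ?a j"
        using j ac rS by (simp add: generator_cancel)
      then have "len w \<le> len (v \<otimes> r) + j"
        using wr len_mult_le[of "v \<otimes> r" "?a j"] al[of j] v rS ac by auto
      then show False using lr v j by linarith
    qed
  qed
  \<comment> \<open>With at least \<open>m s t\<close> alternating letters the braid relation makes
    \<open>s\<close> the last letter, so that multiplying by \<open>s\<close> would shorten
    \<open>w\<close>.\<close>
  have bd: "k < m s t" if nz: "m s t \<noteq> 0"
  proof (rule ccontr)
    assume "\<not> k < m s t"
    then obtain d where d: "k = d + m s t" by (metis add.commute le_add_diff_inverse2 not_less)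
    obtain xs where xs: "set xs \<subseteq> {s, t}" "length xs = d"
      "alternating k s t = xs @ alternating (m s t) s t"
      using alternating_add d by metis
    obtain q where q: "m s t = Suc q" using nz by (cases "m s t") auto
    have xsS: "xs \<in> lists S" using xs s t by auto
    have "?a k \<otimes> s = word_prod G xs \<otimes> word_prod G (alternating (m s t) t s) \<otimes> s"
      using xs xsS braid[OF s t] s t by (simp add: word_prod_append alternating_in_lists)
    also have "\<dots> = word_prod G xs \<otimes> (word_prod G (alternating q s t) \<otimes> s \<otimes> s)"
      unfolding q alternating_snoc using xsS s t
      by (simp add: word_prod_append alternating_in_lists m_assoc)
    also have "\<dots> = word_prod G (xs @ alternating q s t)"
      using xsS s t by (simp add: word_prod_append alternating_in_lists generator_cancel_right)
    finally have "len (?a k \<otimes> s) \<le> d + q"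
      using len_le[of "xs @ alternating q s t"] xs xsS s t by (simp add: alternating_in_lists)
    moreover have "len (w \<otimes> s) \<le> len v + len (?a k \<otimes> s)"
      using len_mult_le[of v "?a k \<otimes> s"] v ac s by (simp add: m_assoc)
    ultimately show False using up v d q by linarith
  qed
  have "len v < len w" using v k1 by linarith
  then show thesis using that[OF v(1,2) _ * * bd] by blast
qed

end

context geometric_representation
begin

section \<open>The action on the root system\<close>

lemma act_one [simp]: "act \<one> v = v"
  using group_action.id_eq_one[OF action] by (metis UNIV_I restrict_apply')

lemma act_mult: "g \<in> carrier G \<Longrightarrow> h \<in> carrier G \<Longrightarrow> act (g \<otimes> h) v = act g (act h v)"
  by (rule group_action.composition_rule[OF action]) auto

lemma act_inv_left [simp]: "g \<in> carrier G \<Longrightarrow> act (inv g) (act g v) = v"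
  by (simp flip: act_mult)

lemma act_inv_right [simp]: "g \<in> carrier G \<Longrightarrow> act g (act (inv g) v) = v"
  by (simp flip: act_mult)

lemma act_gen_square [simp]: "s \<in> S \<Longrightarrow> act s (act s v) = v"
  by (simp add: generator_square flip: act_mult)

lemma act_generator_image_iff: "s \<in> S \<Longrightarrow> b \<in> act s ` X \<longleftrightarrow> act s b \<in> X"
  by (metis act_gen_square image_iff)

lemmas B_simps = bilinear_ladd[OF form_bilinear] bilinear_radd[OF form_bilinear]
  bilinear_lmul[OF form_bilinear] bilinear_rmul[OF form_bilinear]
  bilinear_lneg[OF form_bilinear] bilinear_rneg[OF form_bilinear]
  bilinear_lsub[OF form_bilinear] bilinear_rsub[OF form_bilinear]
  bilinear_lzero[OF form_bilinear] bilinear_rzero[OF form_bilinear]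

lemma B_sum_right: "B u (\<Sum>x\<in>A. f x) = (\<Sum>x\<in>A. B u (f x))"
  by (induction A rule: infinite_finite_induct) (simp_all add: B_simps)

text \<open>The locale only asks for an action on the set of vectors; linearity is inherited from
  the formula for the generators.\<close>

lemma linear_act: "w \<in> carrier G \<Longrightarrow> linear (act w)"
proof (induction rule: carrier_induct)
  case one
  then show ?case by (simp add: linear_iff)
next
  case (mult s w)
  then have "w \<in> carrier G" by (simp add: generators_generate)
  then show ?case
    using mult by (simp add: linear_iff act_mult act_generator B_simps algebra_simps)
qed

lemma act_simps:
  assumes "w \<in> carrier G"
  shows "act w (u + v) = act w u + act w v" "act w (u - v) = act w u - act w v"
    "act w (c *\<^sub>R v) = c *\<^sub>R act w v" "act w (- v) = - act w v" "act w 0 = 0"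
  using linear_act[OF assms]
  by (simp_all add: linear_add linear_diff linear_scale linear_neg linear_0)

lemma B_act: "w \<in> carrier G \<Longrightarrow> B (act w u) (act w v) = B u v"
proof (induction rule: carrier_induct)
  case (mult s w)
  have *: "B (act s u) (act s v) = B u v" if "s \<in> S" for u v
    using that form_sym[of u "\<alpha> s"]
    by (simp add: act_generator B_simps form_diag algebra_simps)
  show ?case using mult * by (simp add: act_mult generators_generate)
qed simp

lemma act_simple: "s \<in> S \<Longrightarrow> act s (\<alpha> s) = - \<alpha> s"
  by (simp add: act_generator form_diag scaleR_2)

section \<open>Coordinates and the positive cone\<close>

definition coord :: "'v \<Rightarrow> 'g \<Rightarrow> real" where
  "coord v s = representation (\<alpha> ` S) v (\<alpha> s)"

lemma coord_simps [simp]: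
  "coord (u + v) s = coord u s + coord v s" "coord (u - v) s = coord u s - coord v s"
  "coord (c *\<^sub>R v) s = c * coord v s" "coord (- v) s = - coord v s" "coord 0 s = 0"
  by (simp_all add: coord_def simple_roots_independent simple_roots_span representation_add
      representation_diff representation_scale representation_neg representation_zero)

lemma coord_sum: "coord (\<Sum>x\<in>A. f x) s = (\<Sum>x\<in>A. coord (f x) s)"
  by (induction A rule: infinite_finite_induct) simp_all

lemma coord_simple:
  assumes "s \<in> S" "t \<in> S"
  shows "coord (\<alpha> s) t = (if s = t then 1 else 0)"
  using assms inj_on_eq_iff[OF simple_roots_inj assms(2,1)]
  by (simp add: coord_def representation_basis[OF simple_roots_independent])

text \<open>The finite set of nonzero coordinates is named because a sum over an infinite
  \<open>S\<close> would be 0 by default.\<close>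

lemma coord_expansion:
  obtains F where "finite F" "F \<subseteq> S" "\<And>s. s \<in> S - F \<Longrightarrow> coord v s = 0"
    "v = (\<Sum>s\<in>F. coord v s *\<^sub>R \<alpha> s)"
proof -
  let ?X = "{b. representation (\<alpha> ` S) v b \<noteq> 0}"
  define F where "F = {s\<in>S. coord v s \<noteq> 0}"
  have X: "?X = \<alpha> ` F"
    by (auto simp: F_def coord_def dest: representation_ne_zero)
  have inj: "inj_on \<alpha> F"
    using simple_roots_inj by (rule inj_on_subset) (auto simp: F_def)
  have "finite F"
    using finite_representation[of "\<alpha> ` S" v] X inj by (simp add: finite_image_iff)
  have "v = (\<Sum>b\<in>?X. representation (\<alpha> ` S) v b *\<^sub>R b)"
    using sum_nonzero_representation_eq[OF simple_roots_independent, of v]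
    by (simp add: simple_roots_span)
  then have "v = (\<Sum>s\<in>F. coord v s *\<^sub>R \<alpha> s)"
    unfolding X using inj by (simp add: sum.reindex coord_def)
  from \<open>finite F\<close> _ _ this show thesis
    by (rule that) (auto simp: F_def)
qed

lemma coord_eqI: "(\<And>s. s \<in> S \<Longrightarrow> coord u s = coord v s) \<Longrightarrow> u = v"
proof -
  assume *: "\<And>s. s \<in> S \<Longrightarrow> coord u s = coord v s"
  obtain F where F: "F \<subseteq> S" "u - v = (\<Sum>s\<in>F. coord (u - v) s *\<^sub>R \<alpha> s)"
    using coord_expansion[of "u - v"] by metis
  have "(\<Sum>s\<in>F. coord (u - v) s *\<^sub>R \<alpha> s) = 0"
    using F * by (intro sum.neutral) (auto simp: subset_iff)
  then show "u = v" using F by simp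
qed

lemma simple_cone_iff: "v \<in> simple_cone \<longleftrightarrow> (\<forall>s\<in>S. 0 \<le> coord v s)"
proof
  assume "v \<in> simple_cone"
  then obtain F c where v: "v = (\<Sum>s\<in>F. c s *\<^sub>R \<alpha> s)" "finite F" "F \<subseteq> S" "\<forall>s\<in>F. (c s :: real) \<ge> 0"
    by (auto simp: simple_cone_def)
  show "\<forall>s\<in>S. 0 \<le> coord v s"
    using v(2-) unfolding v(1) coord_sum
    by (auto intro!: sum_nonneg simp: coord_simple subsetD)
next
  assume *: "\<forall>s\<in>S. 0 \<le> coord v s"
  obtain F where F: "finite F" "F \<subseteq> S" "v = (\<Sum>s\<in>F. coord v s *\<^sub>R \<alpha> s)"
    by (rule coord_expansion)
  then show "v \<in> simple_cone"
    unfolding simple_cone_def using * by (auto intro!: exI[of _ F] exI[of _ "coord v"])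
qed

lemma simple_cone_add: "u \<in> simple_cone \<Longrightarrow> v \<in> simple_cone \<Longrightarrow> u + v \<in> simple_cone"
  and simple_cone_scale: "v \<in> simple_cone \<Longrightarrow> 0 \<le> c \<Longrightarrow> c *\<^sub>R v \<in> simple_cone"
  and simple_in_cone: "s \<in> S \<Longrightarrow> \<alpha> s \<in> simple_cone"
  by (auto simp: simple_cone_iff coord_simple)

lemma simple_cone_sum: "(\<And>x. x \<in> A \<Longrightarrow> f x \<in> simple_cone) \<Longrightarrow> (\<Sum>x\<in>A. f x) \<in> simple_cone"
  by (auto simp: simple_cone_iff coord_sum intro: sum_nonneg)

lemma simple_cone_antisym: "v \<in> simple_cone \<Longrightarrow> - v \<in> simple_cone \<Longrightarrow> v = 0"
  by (rule coord_eqI) (force simp: simple_cone_iff)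

section \<open>Every root is positive or negative\<close>

text \<open>Chebyshev polynomials of the second kind, shifted by one index.\<close>

fun cheb :: "real \<Rightarrow> nat \<Rightarrow> real" where
  "cheb c 0 = 0"
| "cheb c (Suc 0) = 1"
| "cheb c (Suc (Suc k)) = c * cheb c (Suc k) - cheb c k"

lemma cheb_cos: "sin x * cheb (2 * cos x) k = sin (real k * x)"
proof (induction "2 * cos x" k rule: cheb.induct)
  case (3 k)
  have "sin x * cheb (2 * cos x) (Suc (Suc k))
      = 2 * cos x * (sin x * cheb (2 * cos x) (Suc k)) - sin x * cheb (2 * cos x) k"
    by (simp add: algebra_simps)
  also have "\<dots> = 2 * cos x * sin (real (Suc k) * x) - sin (real k * x)"
    using 3 by simp
  also have "\<dots> = sin (real (Suc (Suc k)) * x)"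
  proof -
    have e: "real (Suc (Suc k)) * x = real (Suc k) * x + x" "real k * x = real (Suc k) * x - x"
      by (simp_all add: algebra_simps)
    show ?thesis unfolding e sin_add sin_diff by simp
  qed
  finally show ?case .
qed auto

lemma cheb_nonneg_finite:
  assumes "2 \<le> n" "k \<le> n"
  shows "0 \<le> cheb (2 * cos (pi / real n)) k"
proof -
  have "0 < sin (pi / real n)"
    using assms by (intro sin_gt_zero) (auto simp: field_simps)
  moreover have "0 \<le> sin (real k * (pi / real n))"
    using assms by (intro sin_ge_zero) (auto simp: field_simps)
  ultimately show ?thesis
    using cheb_cos[of "pi / real n" k] by (metis not_less mult_pos_neg)
qed

lemma cheb_mono_infinite:
  assumes "2 \<le> c"
  shows "0 \<le> cheb c k \<and> cheb c k \<le> cheb c (Suc k)"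
proof (induction k)
  case (Suc k)
  then have "2 * cheb c (Suc k) \<le> c * cheb c (Suc k)"
    using assms by (intro mult_right_mono) auto
  then show ?case using Suc by auto
qed auto

text \<open>Each further reflection replaces one coordinate by c times the other minus itself, which
  is the recursion of \<open>cheb\<close>; the parity of k tells which coordinate changed
  last.\<close>

lemma act_alternating:
  assumes "s \<in> S" "t \<in> S"
  defines "c \<equiv> - 2 * B (\<alpha> s) (\<alpha> t)"
  shows "act (word_prod G (alternating k s t)) (\<alpha> s) =
    (if even k then cheb c (Suc k) *\<^sub>R \<alpha> s + cheb c k *\<^sub>R \<alpha> t
     else cheb c k *\<^sub>R \<alpha> s + cheb c (Suc k) *\<^sub>R \<alpha> t)"
proof (induction k)
  case (Suc k)
  have c: "word_prod G (alternating k s t) \<in> carrier G"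
    using assms by (simp add: alternating_in_lists)
  have st: "act s (\<alpha> s) = - \<alpha> s" "act s (\<alpha> t) = \<alpha> t + c *\<^sub>R \<alpha> s"
    "act t (\<alpha> t) = - \<alpha> t" "act t (\<alpha> s) = \<alpha> s + c *\<^sub>R \<alpha> t"
    using assms form_sym[of "\<alpha> t" "\<alpha> s"] by (simp_all add: act_simple) (simp_all add: act_generator)
  show ?case
    using assms c Suc.IH by (auto simp: act_mult act_simps st algebra_simps)
qed simp

lemma act_alternating_in_cone:
  assumes "s \<in> S" "t \<in> S" "s \<noteq> t" "m s t \<noteq> 0 \<Longrightarrow> k < m s t"
  obtains p q where "0 \<le> p" "0 \<le> q"
    "act (word_prod G (alternating k s t)) (\<alpha> s) = p *\<^sub>R \<alpha> s + q *\<^sub>R \<alpha> t"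
proof -
  define c where "c = - 2 * B (\<alpha> s) (\<alpha> t)"
  \<comment> \<open>For a finite label both k and \<open>Suc k\<close> are at most
    \<open>m s t\<close>, where sin (k pi / m) is still nonnegative. For an infinite label c is at
    least 2 and the values increase.\<close>
  have "0 \<le> cheb c k \<and> 0 \<le> cheb c (Suc k)"
  proof (cases "m s t = 0")
    case True
    then have "2 \<le> c" using form_infinite[of s t] assms by (simp add: c_def)
    then show ?thesis using cheb_mono_infinite[of c k] by linarith
  next
    case False
    then have "c = 2 * cos (pi / real (m s t))"
      using form_finite[of s t] assms by (simp add: c_def)
    then show ?thesis
      using cheb_nonneg_finite[OF m_ge_2[OF assms(1-3) False]] assms(4)[OF False] by simp
  qed
  then show thesis
    using that act_alternating[OF assms(1,2), of k] unfolding c_def by (cases "even k") auto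
qed

text \<open>Choose a descent t and split w = v a along the dihedral subgroup of s and t. Then a
  sends \<open>\<alpha> s\<close> to a nonnegative combination of \<open>\<alpha> s\<close> and
  \<open>\<alpha> t\<close>, and the shorter v has ascents at both, so induction applies to each
  summand.\<close>

theorem ascent_positive:
  assumes "w \<in> carrier G" "s \<in> S" "len w < len (w \<otimes> s)"
  shows "act w (\<alpha> s) \<in> simple_cone"
  using assms
proof (induction "len w" arbitrary: w s rule: less_induct)
  case less
  show ?case
  proof (cases "w = \<one>")
    case True
    then show ?thesis using less by (simp add: simple_in_cone)
  next
    case False
    then obtain t where t: "t \<in> S" "len w = Suc (len (w \<otimes> t))"
      using descent_exists less.prems by metis
    then have "s \<noteq> t" using less.prems by auto
    obtain v k where vk: "v \<in> carrier G" "w = v \<otimes> word_prod G (alternating k s t)"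
      "len v < len w" "len v < len (v \<otimes> s)" "len v < len (v \<otimes> t)" "m s t \<noteq> 0 \<Longrightarrow> k < m s t"
      using alternating_factorization[OF less.prems(1,2) t(1) less.prems(3)] t(2) by auto
    obtain p q where pq: "0 \<le> p" "0 \<le> q"
      "act (word_prod G (alternating k s t)) (\<alpha> s) = p *\<^sub>R \<alpha> s + q *\<^sub>R \<alpha> t"
      using act_alternating_in_cone[OF less.prems(2) t(1) \<open>s \<noteq> t\<close> vk(6)] by metis
    have "act w (\<alpha> s) = p *\<^sub>R act v (\<alpha> s) + q *\<^sub>R act v (\<alpha> t)"
      using vk pq less.prems t by (simp add: act_mult act_simps alternating_in_lists)
    then show ?thesis
      using less.hyps[OF vk(3) vk(1)] vk less.prems t pq
      by (auto intro!: simple_cone_add simple_cone_scale)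
  qed
qed

lemma descent_negative:
  assumes "w \<in> carrier G" "s \<in> S" "len (w \<otimes> s) < len w"
  shows "- act w (\<alpha> s) \<in> simple_cone"
  using ascent_positive[of "w \<otimes> s" s] assms
  by (simp add: generator_cancel_right act_mult act_simple act_simps)

lemma roots_act:
  assumes "w \<in> carrier G" "b \<in> roots"
  shows "act w b \<in> roots"
proof -
  obtain v s where "v \<in> carrier G" "s \<in> S" "b = act v (\<alpha> s)"
    using assms by (auto simp: roots_def)
  then show ?thesis
    unfolding roots_def using assms
    by (intro CollectI exI[of _ "w \<otimes> v"] exI[of _ s]) (simp add: act_mult)
qed

lemma simple_root: "s \<in> S \<Longrightarrow> \<alpha> s \<in> roots"
  unfolding roots_def by (intro CollectI exI[of _ \<one>] exI[of _ s]) simp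

lemma root_cases:
  assumes "b \<in> roots"
  obtains w s where "w \<in> carrier G" "s \<in> S" "b = act w (\<alpha> s)"
  using assms unfolding roots_def by auto

lemma roots_uminus: "b \<in> roots \<Longrightarrow> - b \<in> roots"
proof (erule root_cases)
  fix w s assume *: "w \<in> carrier G" "s \<in> S" "b = act w (\<alpha> s)"
  then have "- b = act (w \<otimes> s) (\<alpha> s)"
    by (simp add: act_mult act_simple act_simps)
  then show "- b \<in> roots" using * by (metis generator_closed m_closed roots_act simple_root)
qed

lemma root_norm: "b \<in> roots \<Longrightarrow> B b b = 1"
  by (erule root_cases) (simp add: B_act form_diag)

lemma root_nonzero: "b \<in> roots \<Longrightarrow> b \<noteq> 0"
  using root_norm[of b] by (auto simp: B_simps)

lemma root_positive_or_negative: "b \<in> roots \<Longrightarrow> b \<in> pos_roots \<or> - b \<in> pos_roots"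
proof (erule root_cases)
  fix w s assume *: "w \<in> carrier G" "s \<in> S" "b = act w (\<alpha> s)"
  then have b: "b \<in> roots" by (simp add: roots_act simple_root)
  then have nb: "- b \<in> roots" by (rule roots_uminus)
  from b nb show "b \<in> pos_roots \<or> - b \<in> pos_roots"
    unfolding pos_roots_def
    using len_mult_generator[of w s] ascent_positive[of w s] descent_negative[of w s] * by auto
qed

lemma pos_root_uminus: "b \<in> pos_roots \<Longrightarrow> - b \<notin> pos_roots"
  using simple_cone_antisym[of b] root_nonzero[of b] by (auto simp: pos_roots_def)

lemma root_negative_iff: "b \<in> roots \<Longrightarrow> - b \<in> pos_roots \<longleftrightarrow> b \<notin> pos_roots"
  using root_positive_or_negative[of b] pos_root_uminus[of b] by blast

lemma pos_root_root: "b \<in> pos_roots \<Longrightarrow> b \<in> roots"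
  and pos_root_cone: "b \<in> pos_roots \<Longrightarrow> b \<in> simple_cone"
  by (auto simp: pos_roots_def)

lemma simple_pos_root: "s \<in> S \<Longrightarrow> \<alpha> s \<in> pos_roots"
  by (simp add: pos_roots_def simple_root simple_in_cone)

lemma pos_rootI_coord:
  assumes "b \<in> roots" "s \<in> S" "0 < coord b s"
  shows "b \<in> pos_roots"
  using root_positive_or_negative[OF assms(1)] assms
  by (force simp: pos_roots_def simple_cone_iff)

lemma root_coord_determined:
  assumes "b \<in> pos_roots" "s \<in> S" "\<And>t. t \<in> S \<Longrightarrow> t \<noteq> s \<Longrightarrow> coord b t = 0"
  shows "b = \<alpha> s"
proof -
  have b: "b = coord b s *\<^sub>R \<alpha> s"
    using assms by (intro coord_eqI) (auto simp: coord_simple)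
  have "B b b = coord b s * coord b s"
    by (subst (1 2) b) (simp add: B_simps form_diag assms(2))
  then have "coord b s * coord b s = 1"
    using root_norm[of b] assms by (simp add: pos_roots_def)
  moreover have "0 \<le> coord b s"
    using assms by (simp add: pos_roots_def simple_cone_iff)
  ultimately have "coord b s = 1"
    by (metis abs_of_nonneg abs_square_eq_1 power2_eq_square)
  then show ?thesis using b by simp
qed

text \<open>The reflection changes only the coordinate at \<open>s\<close>, and a positive root
  other than \<open>\<alpha> s\<close> has another positive coordinate, which decides the sign of
  the image.\<close>

lemma act_generator_pos_root:
  assumes "s \<in> S" "b \<in> pos_roots" "b \<noteq> \<alpha> s"
  shows "act s b \<in> pos_roots"
proof -
  obtain t where "t \<in> S" "t \<noteq> s" "coord b t \<noteq> 0"
    using root_coord_determined assms by blast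
  moreover have "0 \<le> coord b t"
    using assms \<open>t \<in> S\<close> by (simp add: pos_roots_def simple_cone_iff)
  moreover have "coord (act s b) t = coord b t"
    using assms \<open>t \<in> S\<close> \<open>t \<noteq> s\<close> by (simp add: act_generator coord_simple)
  moreover have "act s b \<in> roots"
    using assms by (simp add: roots_act pos_root_root)
  ultimately show ?thesis
    by (intro pos_rootI_coord[of _ t]) auto
qed

section \<open>Inversion sets\<close>

lemma inversions_iff:
  assumes "w \<in> carrier G"
  shows "b \<in> inversions w \<longleftrightarrow> b \<in> pos_roots \<and> act (inv w) b \<notin> pos_roots"
proof -
  have "b \<in> act w ` neg_roots \<longleftrightarrow> - act (inv w) b \<in> pos_roots"
  proof
    assume "b \<in> act w ` neg_roots"
    then show "- act (inv w) b \<in> pos_roots"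
      using assms by (auto simp: neg_roots_def)
  next
    assume "- act (inv w) b \<in> pos_roots"
    then show "b \<in> act w ` neg_roots"
      unfolding neg_roots_def using assms
      by (intro image_eqI[of _ _ "act (inv w) b"] image_eqI[of _ _ "- act (inv w) b"]) auto
  qed
  then show ?thesis
    unfolding inversions_def
    using assms root_negative_iff[of "act (inv w) b"] by (auto simp: roots_act pos_root_root)
qed

lemma inversions_iff_neg:
  "w \<in> carrier G \<Longrightarrow> b \<in> inversions w \<longleftrightarrow> b \<in> pos_roots \<and> - act (inv w) b \<in> pos_roots"
  using inversions_iff[of w b] root_negative_iff[of "act (inv w) b"] by (auto simp: roots_act pos_root_root)

lemma inversions_pos_roots: "b \<in> inversions w \<Longrightarrow> b \<in> pos_roots"
  by (simp add: inversions_def)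

lemma inversions_one [simp]: "inversions \<one> = {}"
  by (auto simp: inversions_iff)

lemma inversions_mult_generator_left:
  assumes w: "w \<in> carrier G" and s: "s \<in> S" and n: "\<alpha> s \<notin> inversions w"
  shows "inversions (s \<otimes> w) = insert (\<alpha> s) (act s ` inversions w)"
proof -
  have e: "act (inv (s \<otimes> w)) b = act (inv w) (act s b)" for b
    using w s by (simp add: inv_mult_group generator_inv act_mult)
  have a: "act (inv w) (\<alpha> s) \<in> pos_roots"
    using n w s by (simp add: inversions_iff simple_pos_root)
  have "b \<in> inversions (s \<otimes> w) \<longleftrightarrow> b = \<alpha> s \<or> act s b \<in> inversions w" for b
  proof (cases "b = \<alpha> s")
    case True
    then show ?thesis using w s a
      by (simp add: inversions_iff e act_simple act_simps simple_pos_root pos_root_uminus)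
  next
    case False
    have "b \<in> pos_roots \<longleftrightarrow> act s b \<in> pos_roots" if "act (inv w) (act s b) \<notin> pos_roots"
    proof
      assume "act s b \<in> pos_roots"
      moreover have "act s b \<noteq> \<alpha> s" using that a by auto
      ultimately show "b \<in> pos_roots" using act_generator_pos_root[of s "act s b"] s by simp
    qed (use False act_generator_pos_root s in blast)
    then show ?thesis
      using w s False by (auto simp: inversions_iff e)
  qed
  then show ?thesis
    by (simp add: set_eq_iff act_generator_image_iff[OF s])
qed

lemma inversions_generator: "s \<in> S \<Longrightarrow> inversions s = {\<alpha> s}"
  using inversions_mult_generator_left[of \<one> s] by simp

lemma inversions_mult_generator_left_cancel:
  assumes w: "w \<in> carrier G" and s: "s \<in> S" and n: "\<alpha> s \<in> inversions w"
  shows "\<alpha> s \<notin> inversions (s \<otimes> w)" "inversions w = insert (\<alpha> s) (act s ` inversions (s \<otimes> w))"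
proof -
  show *: "\<alpha> s \<notin> inversions (s \<otimes> w)"
    using n inversions_iff_neg[OF w, of "\<alpha> s"] w s
    by (simp add: inversions_iff[of "s \<otimes> w"] inv_mult_group generator_inv act_mult act_simple act_simps)
  show "inversions w = insert (\<alpha> s) (act s ` inversions (s \<otimes> w))"
    using inversions_mult_generator_left[of "s \<otimes> w" s] * w s by (simp add: generator_cancel)
qed

lemma inversions_mult_generator_left_subset:
  assumes w: "w \<in> carrier G" and s: "s \<in> S"
  shows "inversions (s \<otimes> w) \<subseteq> insert (\<alpha> s) (act s ` inversions w)"
proof (cases "\<alpha> s \<in> inversions w")
  case True
  show ?thesis
    using inversions_mult_generator_left_cancel(2)[OF w s True] s by (auto simp: image_iff)
qed (use inversions_mult_generator_left[OF w s] in simp)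

lemma finite_inversions: "w \<in> carrier G \<Longrightarrow> finite (inversions w)"
proof (induction rule: carrier_induct)
  case (mult s w)
  then show ?case
    using inversions_mult_generator_left_subset[of w s]
    by (auto intro: finite_subset simp: generators_generate)
qed simp

text \<open>Right multiplication adds a single root and keeps the others in place, whereas left
  multiplication moves the whole set by \<open>s\<close>.\<close>

lemma inversions_mult_generator_right:
  assumes w: "w \<in> carrier G" and s: "s \<in> S" and p: "act w (\<alpha> s) \<in> pos_roots"
  shows "inversions (w \<otimes> s) = insert (act w (\<alpha> s)) (inversions w)" "act w (\<alpha> s) \<notin> inversions w"
proof -
  have e: "act (inv (w \<otimes> s)) b = act s (act (inv w) b)" for b
    using w s by (simp add: inv_mult_group generator_inv act_mult)
  show "act w (\<alpha> s) \<notin> inversions w"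
    using w s by (simp add: inversions_iff simple_pos_root)
  have "b \<in> inversions (w \<otimes> s) \<longleftrightarrow> b = act w (\<alpha> s) \<or> b \<in> inversions w" for b
  proof (cases "act (inv w) b = \<alpha> s")
    case True
    then have "b = act w (\<alpha> s)" using w by (metis act_inv_right)
    then show ?thesis using w s p
      by (simp add: inversions_iff e act_simple pos_root_uminus simple_pos_root)
  next
    case False
    then have ne: "b \<noteq> act w (\<alpha> s)" using w by auto
    have "act s (act (inv w) b) \<in> pos_roots \<longleftrightarrow> act (inv w) b \<in> pos_roots" if "b \<in> pos_roots"
    proof
      assume "act s (act (inv w) b) \<in> pos_roots"
      moreover have "act s (act (inv w) b) \<noteq> \<alpha> s"
      proof
        assume "act s (act (inv w) b) = \<alpha> s"
        then have "act (inv w) b = - \<alpha> s"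
          using s by (metis act_gen_square act_simple)
        then have "b = - act w (\<alpha> s)"
          using w by (metis act_inv_right act_simps(4))
        then show False using that p pos_root_uminus by blast
      qed
      ultimately show "act (inv w) b \<in> pos_roots"
        using act_generator_pos_root[of s "act s (act (inv w) b)"] s by simp
    qed (use False act_generator_pos_root s in blast)
    then show ?thesis
      using w s ne by (auto simp: inversions_iff e)
  qed
  then show "inversions (w \<otimes> s) = insert (act w (\<alpha> s)) (inversions w)" by auto
qed

lemma card_inversions_mult_descent:
  assumes w: "w \<in> carrier G" and s: "s \<in> S" and n: "act w (\<alpha> s) \<notin> pos_roots"
  shows "card (inversions w) = Suc (card (inversions (w \<otimes> s)))"
proof -
  have "act (w \<otimes> s) (\<alpha> s) \<in> pos_roots"
    using w s n root_negative_iff[of "act w (\<alpha> s)"]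
    by (simp add: act_mult act_simple act_simps roots_act simple_root)
  then show ?thesis
    using inversions_mult_generator_right[of "w \<otimes> s" s] w s finite_inversions[of "w \<otimes> s"]
    by (simp add: generator_cancel_right)
qed

lemma inversions_nonempty:
  assumes "w \<in> carrier G" "w \<noteq> \<one>"
  obtains s where "s \<in> S" "\<alpha> s \<in> inversions w"
proof -
  have "inv w \<noteq> \<one>" using assms by (metis inv_inv inv_one)
  then obtain s where s: "s \<in> S" "len (inv w) = Suc (len (inv w \<otimes> s))"
    using descent_exists[of "inv w"] assms by auto
  then have "- act (inv w) (\<alpha> s) \<in> simple_cone"
    using descent_negative[of "inv w" s] assms by auto
  then have "\<alpha> s \<in> inversions w"
    using assms s roots_uminus[OF roots_act[of "inv w" "\<alpha> s"]]
    by (simp add: inversions_iff_neg simple_pos_root simple_root) (simp add: pos_roots_def)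
  with s that show thesis by blast
qed

lemma card_inversions_mult_left:
  assumes "w \<in> carrier G" "s \<in> S" "\<alpha> s \<in> inversions w"
  shows "card (inversions w) = Suc (card (inversions (s \<otimes> w)))"
proof -
  note c = inversions_mult_generator_left_cancel[OF assms]
  have "\<alpha> s \<notin> act s ` inversions (s \<otimes> w)"
  proof
    assume "\<alpha> s \<in> act s ` inversions (s \<otimes> w)"
    then obtain b where "\<alpha> s = act s b" "b \<in> pos_roots"
      by (auto dest: inversions_pos_roots)
    then show False
      using assms(2) by (metis act_gen_square act_simple pos_root_uminus simple_pos_root)
  qed
  moreover have "inj_on (act s) (inversions (s \<otimes> w))"
    using assms(2) by (metis act_gen_square inj_onI)
  ultimately show ?thesis
    unfolding c(2) using assms finite_inversions[of "s \<otimes> w"] by (simp add: card_image)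
qed

text \<open>A simple root in the common inversion set lets s be stripped from both elements, and
  N(su) is determined by N(u). Injectivity is what bounds a subgroup by a set of roots.\<close>

lemma inversions_inj: "inj_on inversions (carrier G)"
proof (rule inj_onI)
  fix u w assume "u \<in> carrier G" "w \<in> carrier G" "inversions u = inversions w"
  then show "u = w"
  proof (induction "card (inversions u)" arbitrary: u w rule: less_induct)
    case less
    show ?case
    proof (cases "u = \<one>")
      case True
      then show ?thesis using less.prems by (metis empty_iff inversions_nonempty inversions_one)
    next
      case False
      then obtain s where s: "s \<in> S" "\<alpha> s \<in> inversions u"
        using inversions_nonempty less.prems by blast
      have e: "inversions (s \<otimes> v) = act s ` (inversions v - {\<alpha> s})"
        if "v \<in> carrier G" "\<alpha> s \<in> inversions v" for v
      proof -
        note c = inversions_mult_generator_left_cancel[OF that(1) s(1) that(2)]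
        have "- \<alpha> s \<notin> inversions (s \<otimes> v)"
          using s pos_root_uminus simple_pos_root inversions_pos_roots by blast
        then have "\<alpha> s \<notin> act s ` inversions (s \<otimes> v)"
          using s(1) by (metis (no_types, lifting) act_gen_square act_simple image_iff)
        then have "inversions v - {\<alpha> s} = act s ` inversions (s \<otimes> v)"
          using c by blast
        then show ?thesis using s(1) by (simp add: image_image)
      qed
      have "inversions (s \<otimes> u) = inversions (s \<otimes> w)"
        using e[of u] e[of w] less.prems s by simp
      moreover have "card (inversions (s \<otimes> u)) < card (inversions u)"
        using card_inversions_mult_left[of u s] less.prems s by simp
      ultimately have "s \<otimes> u = s \<otimes> w"
        using less.hyps[of "s \<otimes> u" "s \<otimes> w"] less.prems s by simp
      then show ?thesis using less.prems s by (simp add: generator_closed)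
    qed
  qed
qed

section \<open>Finite parabolic subgroups\<close>

text \<open>The stable set contains the inversion sets of all elements of the subgroup, and these
  sets determine the elements.\<close>

lemma finite_generateI:
  assumes I: "I \<subseteq> S" and fin: "finite R"
    and simple: "\<And>s. s \<in> I \<Longrightarrow> \<alpha> s \<in> R"
    and stable: "\<And>s v. s \<in> I \<Longrightarrow> v \<in> R \<Longrightarrow> act s v \<in> R"
  shows "finite (generate G I)"
proof -
  have "inversions w \<subseteq> R" if "w \<in> generate G I" for w
    using that I
  proof (induction rule: generate_word_induct)
    case (mult s w)
    then show ?case
      using inversions_mult_generator_left_subset[of w s] generate_closed[OF I] I simple stable by blast
  qed simp
  then have "inversions ` generate G I \<subseteq> Pow R" by blast
  moreover have "inj_on inversions (generate G I)"
    using inversions_inj by (rule inj_on_subset) (use generate_closed[OF I] in blast)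
  ultimately show ?thesis
    using fin by (meson finite_Pow_iff inj_on_finite)
qed

text \<open>The powers of x = st and their products with s form a finite set that is stable under
  left multiplication by s and by t = sx, because s inverts x.\<close>

lemma finite_dihedral:
  assumes s: "s \<in> S" and t: "t \<in> S" and fin: "m s t \<noteq> 0"
  shows "finite (generate G {s, t})"
proof -
  define x where "x = s \<otimes> t"
  have x: "x \<in> carrier G" using s t by (simp add: x_def)
  define n where "n = ord x"
  have n: "n > 0" using fin by (simp add: n_def x_def m_def)
  define H where "H = (\<lambda>i. x [^] (i::nat)) ` UNIV"
  have "H \<subseteq> (\<lambda>i. x [^] i) ` {..<n}"
  proof
    fix h assume "h \<in> H"
    then obtain i :: nat where "h = x [^] i" by (auto simp: H_def)
    also have "x [^] i = x [^] (n * (i div n) + i mod n)" by simp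
    also have "\<dots> = (x [^] n) [^] (i div n) \<otimes> x [^] (i mod n)"
      using x by (simp add: nat_pow_mult nat_pow_pow)
    also have "\<dots> = x [^] (i mod n)"
      using x pow_ord_eq_1[OF x] by (simp add: n_def)
    finally show "h \<in> (\<lambda>i. x [^] i) ` {..<n}" using n by auto
  qed
  then have "finite H" by (rule finite_subset) simp
  have Hc: "H \<subseteq> carrier G" using x by (auto simp: H_def)
  \<comment> \<open>The set \<open>H\<close> has natural exponents only, so the inverse of x has to
    be one of these powers.\<close>
  have inv_x: "inv x = x [^] (n - 1)"
  proof -
    have "x [^] (n - 1) \<otimes> x = x [^] n"
      using n x by (metis Suc_diff_1 nat_pow_Suc)
    then show ?thesis using x pow_ord_eq_1[OF x] by (simp add: n_def inv_equality)
  qed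
  have sx: "s \<otimes> x [^] i = (inv x) [^] i \<otimes> s" for i :: nat
  proof (induction i)
    case (Suc i)
    have "s \<otimes> x [^] Suc i = (s \<otimes> x [^] i) \<otimes> x"
      using s x by (simp add: m_assoc)
    also have "\<dots> = (inv x) [^] i \<otimes> (s \<otimes> x)"
      using Suc s x by (simp add: m_assoc)
    also have "s \<otimes> x = inv x \<otimes> s"
      using s t by (simp add: x_def inv_mult_group generator_inv m_assoc generator_cancel generator_square)
    finally show ?case using s x by (simp add: m_assoc)
  qed (use s in simp)
  have inv_pow: "(inv x) [^] i \<in> H" for i :: nat
    unfolding inv_x H_def using x by (simp add: nat_pow_pow)
  define K where "K = H \<union> (\<lambda>h. h \<otimes> s) ` H"
  have sK: "s \<otimes> k \<in> K" if "k \<in> K" for k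
  proof -
    have "s \<otimes> h \<in> (\<lambda>h. h \<otimes> s) ` H" if "h \<in> H" for h
      using that sx inv_pow by (auto simp: H_def)
    moreover have "s \<otimes> (h \<otimes> s) \<in> H" if "h \<in> H" for h
    proof -
      obtain i :: nat where i: "h = x [^] i" using \<open>h \<in> H\<close> by (auto simp: H_def)
      have "s \<otimes> (h \<otimes> s) = (inv x) [^] i \<otimes> s \<otimes> s"
        using sx[of i] s x i by (simp flip: m_assoc)
      then show ?thesis using inv_pow[of i] s x by (simp add: generator_cancel_right)
    qed
    ultimately show ?thesis using that unfolding K_def by blast
  qed
  have xK: "x \<otimes> k \<in> K" if "k \<in> K" for k
  proof -
    have *: "x \<otimes> h \<in> H" if "h \<in> H" for h
    proof -
      obtain i :: nat where i: "h = x [^] i" using \<open>h \<in> H\<close> by (auto simp: H_def)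
      then have "x \<otimes> h = x [^] Suc i" using nat_pow_Suc2[OF x] by metis
      then show ?thesis unfolding H_def by blast
    qed
    have "x \<otimes> (h \<otimes> s) = x \<otimes> h \<otimes> s" if "h \<in> H" for h
      using that Hc x s by (simp add: m_assoc subsetD)
    then show ?thesis using that * unfolding K_def by force
  qed
  have Kc: "K \<subseteq> carrier G" using Hc s by (auto simp: K_def)
  have tK: "t \<otimes> k \<in> K" if "k \<in> K" for k
  proof -
    have "t \<otimes> k = s \<otimes> (x \<otimes> k)"
      using s t Kc that by (simp add: x_def m_assoc generator_cancel subsetD)
    then show ?thesis using sK xK that by simp
  qed
  have "\<one> \<in> K" unfolding K_def H_def by (auto intro: image_eqI[of _ _ 0])
  have "w \<in> K" if "w \<in> generate G {s, t}" for w
    using that _ \<open>\<one> \<in> K\<close> by (rule generate_word_induct) (use s t sK tK in auto)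
  moreover have "finite K" using \<open>finite H\<close> by (simp add: K_def)
  ultimately show ?thesis by (meson finite_subset subsetI)
qed

lemma coord_act_parabolic:
  assumes "I \<subseteq> S" "x \<in> generate G I" "t \<in> S - I"
  shows "coord (act x v) t = coord v t"
  using assms(2,1)
proof (induction rule: generate_word_induct)
  case (mult s w)
  then have "s \<in> S" "w \<in> carrier G" using assms generate_closed by auto
  moreover have "coord (\<alpha> s) t = 0" using mult assms by (auto simp: coord_simple)
  ultimately show ?case using mult by (simp add: act_mult act_generator)
qed simp

lemma act_sum: "w \<in> carrier G \<Longrightarrow> act w (\<Sum>x\<in>A. f x) = (\<Sum>x\<in>A. act w (f x))"
  by (rule linear_sum[OF linear_act])

text \<open>
  An element \<open>x\<close> with a maximal inversion set disjoint from that of \<open>w\<close> makes \<open>w\<inverse> x\<close> send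
  every simple root of \<open>I\<close> to a negative root, so that every positive root of \<open>I\<close> is an
  inversion of \<open>w\<close> or of \<open>x\<close>.
\<close>

lemma parabolic_complement:
  assumes I: "I \<subseteq> S" and fin: "finite (generate G I)" and w: "w \<in> carrier G"
    and b: "b \<in> pos_roots" "b \<notin> inversions w" and bI: "\<And>s. s \<in> S - I \<Longrightarrow> coord b s = 0"
  obtains x where "x \<in> generate G I" "inversions x \<inter> inversions w = {}" "b \<in> inversions x"
proof -
  define X where "X = {x \<in> generate G I. inversions x \<inter> inversions w = {}}"
  let ?f = "\<lambda>x. card (inversions x)"
  have "finite X" using fin by (simp add: X_def)
  moreover have "\<one> \<in> X" by (simp add: X_def generate.one)
  ultimately have "Max (?f ` X) \<in> ?f ` X" by (intro Max_in) auto
  then obtain x where x: "x \<in> X" "?f x = Max (?f ` X)" by auto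
  then have max: "?f y \<le> ?f x" if "y \<in> X" for y
    using that \<open>finite X\<close> by simp
  have xI: "x \<in> generate G I" and xw: "inversions x \<inter> inversions w = {}"
    using x by (auto simp: X_def)
  have xc: "x \<in> carrier G" using generate_closed[OF I xI] .
  \<comment> \<open>If x sends \<open>\<alpha> s\<close> to a positive root, maximality puts that
    root into N(w). Otherwise its negative lies in N(x), hence outside N(w). Both say the same about
    the sign after applying the inverse of w.\<close>
  have neg: "- act (inv w) (act x (\<alpha> s)) \<in> simple_cone" if s: "s \<in> I" for s
  proof -
    have sS: "s \<in> S" using s I by blast
    have r: "act x (\<alpha> s) \<in> roots" using xc sS by (simp add: roots_act simple_root)
    have "- act (inv w) (act x (\<alpha> s)) \<in> pos_roots"
    proof (cases "act x (\<alpha> s) \<in> pos_roots")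
      case True
      note i = inversions_mult_generator_right[OF xc sS True]
      have "?f (x \<otimes> s) > ?f x"
        using i finite_inversions[OF xc] by simp
      then have "x \<otimes> s \<notin> X" using max[of "x \<otimes> s"] by linarith
      moreover have "x \<otimes> s \<in> generate G I"
        using xI s by (simp add: generate.eng generate.incl)
      ultimately have "act x (\<alpha> s) \<in> inversions w"
        using i xw by (auto simp: X_def)
      then show ?thesis using w by (simp add: inversions_iff_neg)
    next
      case False
      then have p: "- act x (\<alpha> s) \<in> pos_roots" using r by (simp add: root_negative_iff)
      have "- act x (\<alpha> s) \<in> inversions x"
        using p xc sS by (simp add: inversions_iff_neg act_simps simple_pos_root)
      then have "- act x (\<alpha> s) \<notin> inversions w" using xw by blast
      then show ?thesis using p w by (simp add: inversions_iff act_simps)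
    qed
    then show ?thesis by (rule pos_root_cone)
  qed
  define c where "c = act (inv x) b"
  have "inv x \<in> generate G I"
    using generate_m_inv_closed[OF _ xI] I generators_subset by blast
  then have cI: "coord c s = 0" if "s \<in> S - I" for s
    using that coord_act_parabolic[OF I _ that, of "inv x" b] bI by (simp add: c_def)
  \<comment> \<open>Otherwise c is a nonnegative combination of simple roots of \<open>I\<close>;
    all of them become negative under the inverse of w times x, so b would be an inversion of
    w.\<close>
  have "b \<in> inversions x"
  proof (rule ccontr)
    assume "b \<notin> inversions x"
    then have "c \<in> pos_roots" using b xc by (simp add: inversions_iff c_def)
    obtain F where F: "finite F" "F \<subseteq> S" "c = (\<Sum>s\<in>F. coord c s *\<^sub>R \<alpha> s)"
      by (rule coord_expansion)
    have "- act (inv w) b = - act (inv w) (act x (\<Sum>s\<in>F. coord c s *\<^sub>R \<alpha> s))"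
      using xc F(3) by (simp add: c_def)
    also have "\<dots> = (\<Sum>s\<in>F. coord c s *\<^sub>R (- act (inv w) (act x (\<alpha> s))))"
      using xc w by (simp add: act_sum act_simps sum_negf)
    also have "\<dots> \<in> simple_cone"
    proof (rule simple_cone_sum)
      fix s assume "s \<in> F"
      then have s: "s \<in> S" using F by blast
      have "0 \<le> coord c s"
        using \<open>c \<in> pos_roots\<close> s by (simp add: pos_roots_def simple_cone_iff)
      then show "coord c s *\<^sub>R (- act (inv w) (act x (\<alpha> s))) \<in> simple_cone"
        using simple_cone_scale[OF neg[of s]] cI[of s] s by (cases "s \<in> I") (simp_all add: simple_cone_iff)
    qed
    finally have "- act (inv w) b \<in> simple_cone" .
    moreover have "- act (inv w) b \<in> roots"
      using w b by (simp add: roots_uminus roots_act pos_root_root)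
    ultimately show False using b w by (simp add: inversions_iff_neg pos_roots_def)
  qed
  then show thesis using that xI xw by blast
qed

section \<open>Spherical roots are small\<close>

lemma support_iff: "s \<in> support b \<longleftrightarrow> s \<in> S \<and> 0 < coord b s"
  by (simp add: support_def coord_def)

lemma support_subset: "support b \<subseteq> S"
  by (auto simp: support_iff)

lemma coord_outside_support: "b \<in> pos_roots \<Longrightarrow> s \<in> S - support b \<Longrightarrow> coord b s = 0"
  by (force simp: support_iff pos_roots_def simple_cone_iff)

lemma spherical_rootI:
  assumes "b \<in> pos_roots" "support b \<subseteq> I" "finite (generate G I)"
  shows "b \<in> spherical_roots"
  using assms mono_generate[of "support b" I] by (auto simp: spherical_roots_def intro: finite_subset)

lemma spherical_complement:
  assumes "b \<in> spherical_roots" "w \<in> carrier G" "b \<notin> inversions w"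
  obtains x where "x \<in> carrier G" "inversions x \<inter> inversions w = {}" "b \<in> inversions x"
proof -
  have "b \<in> pos_roots" "finite (generate G (support b))"
    using assms by (auto simp: spherical_roots_def)
  from parabolic_complement[OF support_subset this(2) assms(2) this(1) assms(3)]
    coord_outside_support[OF this(1)]
  show thesis using that generate_closed[OF support_subset] by metis
qed

text \<open>Write b = v(\<open>\<alpha> s\<close>). As N(vs) is N(v) together with b, any other root
  dominated by b lies in N(v). An element that inverts b and has no inversion in common with v
  refutes this.\<close>

lemma spherical_roots_small: "spherical_roots \<subseteq> small_roots"
proof
  fix b assume sph: "b \<in> spherical_roots"
  then have b: "b \<in> pos_roots" by (simp add: spherical_roots_def)
  show "b \<in> small_roots"
  proof (rule ccontr)
    assume "b \<notin> small_roots"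
    then obtain a where a: "a \<noteq> b" "dominated_by a b"
      using b by (auto simp: small_roots_def)
    obtain v s where v: "v \<in> carrier G" "s \<in> S" "b = act v (\<alpha> s)"
      using root_cases pos_root_root[OF b] by metis
    note i = inversions_mult_generator_right[OF v(1,2), folded v(3), OF b]
    then have "a \<in> inversions v"
      using a v by (auto simp: dominated_by_def)
    moreover obtain x where "x \<in> carrier G" "inversions x \<inter> inversions v = {}" "b \<in> inversions x"
      using spherical_complement[OF sph v(1)] i by blast
    ultimately show False using a by (auto simp: dominated_by_def)
  qed
qed

lemma simple_spherical: "s \<in> S \<Longrightarrow> \<alpha> s \<in> spherical_roots"
proof (rule spherical_rootI)
  assume s: "s \<in> S"
  then show "\<alpha> s \<in> pos_roots" by (rule simple_pos_root)
  \<comment> \<open>The singleton is written as a pair to apply \<open>finite_dihedral\<close>, with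
    \<open>m s s\<close> = 1.\<close>
  show "support (\<alpha> s) \<subseteq> {s, s}" using s by (auto simp: support_iff coord_simple split: if_splits)
  show "finite (generate G {s, s})" using finite_dihedral[OF s s] m_eq_1_iff[OF s s] by simp
qed

lemma simple_small: "s \<in> S \<Longrightarrow> \<alpha> s \<in> small_roots"
  using simple_spherical spherical_roots_small by blast

section \<open>The canonical automaton\<close>

lemma small_roots_pos: "b \<in> small_roots \<Longrightarrow> b \<in> pos_roots"
  by (simp add: small_roots_def)

text \<open>Whether w inverts s(b) is whether sw inverts b, so dominance is transported as long as
  roots stay positive; for a this needs a to differ from \<open>\<alpha> s\<close>.\<close>

lemma dominated_by_act:
  assumes a: "a \<in> pos_roots" "a \<noteq> \<alpha> s" and s: "s \<in> S" and b: "b \<in> pos_roots" and d: "dominated_by a b"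
  shows "dominated_by (act s a) (act s b)"
  unfolding dominated_by_def
proof (intro ballI impI)
  fix w assume w: "w \<in> carrier G" "act s b \<in> inversions w"
  have e: "act (inv (s \<otimes> w)) c = act (inv w) (act s c)" for c
    using w s by (simp add: inv_mult_group generator_inv act_mult)
  have "b \<in> inversions (s \<otimes> w)"
    using w s b by (simp add: inversions_iff e)
  then have "a \<in> inversions (s \<otimes> w)"
    using d w s by (simp add: dominated_by_def)
  then show "act s a \<in> inversions w"
    using w s a act_generator_pos_root[OF s a] by (simp add: inversions_iff e)
qed

text \<open>A root strictly below b would be carried to one strictly below s(b), unless it is
  \<open>\<alpha> s\<close>. The element w, which inverts b but not \<open>\<alpha> s\<close>,
  excludes that exception.\<close>

lemma small_act_small:
  assumes s: "s \<in> S" and b: "b \<in> pos_roots" and small: "act s b \<in> small_roots"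
    and w: "w \<in> carrier G" "b \<in> inversions w" "\<alpha> s \<notin> inversions w"
  shows "b \<in> small_roots"
proof (rule ccontr)
  assume "b \<notin> small_roots"
  then obtain a where a: "a \<in> pos_roots" "a \<noteq> b" "dominated_by a b"
    using b by (auto simp: small_roots_def)
  then have as: "a \<noteq> \<alpha> s" using w by (auto simp: dominated_by_def)
  have "dominated_by (act s a) (act s b)" "act s a \<in> pos_roots"
    using dominated_by_act act_generator_pos_root a as s b by blast+
  moreover have "act s a \<noteq> act s b" using a s by (metis act_gen_square)
  ultimately show False using small by (auto simp: small_roots_def)
qed

text \<open>Small roots of N(su) other than \<open>\<alpha> s\<close> come from small roots of N(u),
  so the next state depends on the present state alone and the transitions follow multiplication in
  the group.\<close>

lemma small_inversions_mult_generator: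
  assumes "u \<in> carrier G" "s \<in> S" "\<alpha> s \<notin> inversions u"
  shows "small_inversions (s \<otimes> u) = {\<alpha> s} \<union> (act s ` small_inversions u \<inter> small_roots)"
  unfolding small_inversions_def inversions_mult_generator_left[OF assms]
  using small_act_small[OF assms(2) inversions_pos_roots _ assms(1) _ assms(3)] simple_small[OF assms(2)]
  by blast

text \<open>Runs are followed on group elements rather than on states; this loses nothing, since
  simple roots are small. Each letter multiplies from the left, so the element reached involves the
  reversed word.\<close>

fun readable :: "'g \<Rightarrow> 'g list \<Rightarrow> bool" where
  "readable u [] \<longleftrightarrow> True"
| "readable u (s # xs) \<longleftrightarrow> s \<in> S \<and> \<alpha> s \<notin> inversions u \<and> readable (s \<otimes> u) xs"

lemma readable_in_lists: "readable u xs \<Longrightarrow> xs \<in> lists S"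
  by (induction u xs rule: readable.induct) auto

lemma reads_canonical_iff:
  assumes "u \<in> carrier G"
  shows "reads canonical_automaton (small_inversions u) xs q \<longleftrightarrow>
    readable u xs \<and> q = small_inversions (word_prod G (rev xs) \<otimes> u)"
  using assms
proof (induction xs arbitrary: u)
  case (Cons s xs)
  have simple: "\<alpha> s \<in> small_inversions u \<longleftrightarrow> \<alpha> s \<in> inversions u" if "s \<in> S"
    using that simple_small by (auto simp: small_inversions_def)
  have "reads canonical_automaton (small_inversions u) (s # xs) q \<longleftrightarrow>
     s \<in> S \<and> \<alpha> s \<notin> inversions u \<and>
     reads canonical_automaton (small_inversions (s \<otimes> u)) xs q"
    using Cons.prems simple small_inversions_mult_generator[of u s]
    by (auto simp: canonical_automaton_def small_inversion_sets_def)
  also have "\<dots> \<longleftrightarrow> readable u (s # xs) \<and> q = small_inversions (word_prod G (rev xs) \<otimes> (s \<otimes> u))"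
    using Cons by auto
  also have "\<dots> \<longleftrightarrow> readable u (s # xs) \<and> q = small_inversions (word_prod G (rev (s # xs)) \<otimes> u)"
  proof -
    have "word_prod G (rev xs) \<otimes> (s \<otimes> u) = word_prod G (rev (s # xs)) \<otimes> u" if "readable u (s # xs)"
    proof -
      have "s \<in> S" "rev xs \<in> lists S" using readable_in_lists[OF that] by auto
      then show ?thesis using Cons.prems by (simp add: word_prod_append m_assoc)
    qed
    then show ?thesis by auto
  qed
  finally show ?case .
qed simp

lemma lang_from_canonical:
  assumes "u \<in> carrier G"
  shows "lang_from canonical_automaton (small_inversions u) = {xs. readable u xs}"
proof -
  have "final canonical_automaton = small_inversion_sets"
    by (simp add: canonical_automaton_def)
  moreover have "small_inversions (word_prod G (rev xs) \<otimes> u) \<in> small_inversion_sets"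
    if "readable u xs" for xs
  proof -
    have "rev xs \<in> lists S" using readable_in_lists[OF that] by auto
    then show ?thesis using assms by (simp add: small_inversion_sets_def)
  qed
  ultimately show ?thesis
    using assms by (auto simp: lang_from_def reads_canonical_iff)
qed

text \<open>Write x = sy for the element of the word. Passing s over to u applies s to both
  inversion sets and moves \<open>\<alpha> s\<close> from one to the other, so N(sy) and N(u) are
  disjoint iff N(y) and N(su) are.\<close>

lemma readable_iff:
  assumes "u \<in> carrier G"
  shows "readable u xs \<longleftrightarrow> readable \<one> xs \<and> inversions (word_prod G xs) \<inter> inversions u = {}"
  using assms
proof (induction xs arbitrary: u)
  case (Cons s xs)
  have IH: "readable v xs \<longleftrightarrow> readable \<one> xs \<and> inversions (word_prod G xs) \<inter> inversions v = {}"
    if "v \<in> carrier G" for v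
    using Cons.IH that by blast
  show ?case
  proof (cases "s \<in> S \<and> readable \<one> xs")
    case True
    then have s: "s \<in> S" and xs: "word_prod G xs \<in> carrier G"
      using readable_in_lists by auto
    have one: "readable \<one> (s # xs) \<longleftrightarrow> \<alpha> s \<notin> inversions (word_prod G xs)"
      using True IH[of s] s by (simp add: inversions_generator)
    show ?thesis
    proof (cases "\<alpha> s \<in> inversions u \<or> \<alpha> s \<in> inversions (word_prod G xs)")
      case True
      have "inversions (word_prod G (s # xs)) \<inter> inversions u \<noteq> {}"
        if "\<alpha> s \<in> inversions u" "readable \<one> (s # xs)"
        using that one inversions_mult_generator_left[OF xs s] by auto
      moreover have "\<not> readable (s \<otimes> u) xs"
        if "\<alpha> s \<notin> inversions u" "\<alpha> s \<in> inversions (word_prod G xs)"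
        using that IH[of "s \<otimes> u"] inversions_mult_generator_left[OF Cons.prems s] Cons.prems s by auto
      ultimately show ?thesis using True one by (metis readable.simps(2))
    next
      case False
      have "readable u (s # xs) \<longleftrightarrow> inversions (word_prod G xs) \<inter> insert (\<alpha> s) (act s ` inversions u) = {}"
        using IH[of "s \<otimes> u"] inversions_mult_generator_left[OF Cons.prems s] False True Cons.prems s
        by simp
      also have "\<dots> \<longleftrightarrow> insert (\<alpha> s) (act s ` inversions (word_prod G xs)) \<inter> inversions u = {}"
        using False by (auto simp: disjoint_iff act_generator_image_iff[OF s]) (metis act_gen_square s)+
      also have "\<dots> \<longleftrightarrow> readable \<one> (s # xs) \<and> inversions (word_prod G (s # xs)) \<inter> inversions u = {}"
        using one False inversions_mult_generator_left[OF xs s] by (simp del: readable.simps)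
      finally show ?thesis .
    qed
  next
    case False
    then show ?thesis
      using IH[of "s \<otimes> u"] IH[of s] Cons.prems by auto
  qed
qed simp

lemma readable_word_exists:
  assumes "w \<in> carrier G"
  obtains xs where "readable \<one> xs" "word_prod G xs = w"
proof -
  have "\<exists>xs. readable \<one> xs \<and> word_prod G xs = w"
    using assms
  proof (induction "card (inversions w)" arbitrary: w rule: less_induct)
    case less
    show ?case
    proof (cases "w = \<one>")
      case True
      then show ?thesis by (intro exI[of _ "[]"]) simp
    next
      case False
      then obtain s where s: "s \<in> S" "\<alpha> s \<in> inversions w"
        using inversions_nonempty less.prems by blast
      then obtain xs where xs: "readable \<one> xs" "word_prod G xs = s \<otimes> w"
        using less.hyps[of "s \<otimes> w"] card_inversions_mult_left[of w s] less.prems by auto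
      have "\<alpha> s \<notin> inversions (s \<otimes> w)"
        using inversions_mult_generator_left_cancel(1) s less.prems by blast
      then have "readable \<one> (s # xs)"
        using s xs readable_iff[of s xs] by (simp add: inversions_generator)
      then show ?thesis
        using xs s less.prems by (intro exI[of _ "s # xs"]) (simp add: generator_cancel)
    qed
  qed
  then show thesis using that by blast
qed

lemma canonical_reachable:
  assumes "w \<in> carrier G"
  shows "\<exists>xs. reads canonical_automaton (initial canonical_automaton) xs (small_inversions w)"
proof -
  \<comment> \<open>Reading multiplies from the left, so a word for the inverse leads to
    \<open>w\<close> itself.\<close>
  obtain xs where xs: "readable \<one> xs" "word_prod G xs = inv w"
    using readable_word_exists[of "inv w"] assms by auto
  have "xs \<in> lists S" using xs by (simp add: readable_in_lists)
  then have "word_prod G (rev xs) = w"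
    using xs assms by (metis inv_inv inv_word_prod)
  moreover have "initial canonical_automaton = small_inversions \<one>"
    by (simp add: canonical_automaton_def small_inversions_def)
  ultimately show ?thesis
    using xs assms by (intro exI[of _ xs]) (simp add: reads_canonical_iff)
qed

lemma minimal_canonical_iff:
  "minimal_automaton canonical_automaton \<longleftrightarrow>
    (\<forall>u\<in>carrier G. \<forall>w\<in>carrier G. (\<forall>xs. readable u xs \<longleftrightarrow> readable w xs) \<longrightarrow>
      small_inversions u = small_inversions w)"
proof -
  have "states canonical_automaton = small_inversions ` carrier G"
    by (simp add: canonical_automaton_def small_inversion_sets_def)
  moreover have "{xs. readable u xs} = {xs. readable w xs} \<longleftrightarrow> (\<forall>xs. readable u xs \<longleftrightarrow> readable w xs)"
    for u w by auto
  ultimately show ?thesis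
    using canonical_reachable by (simp add: minimal_automaton_def lang_from_canonical)
qed

lemma minimal_if_small_spherical:
  assumes "small_roots \<subseteq> spherical_roots"
  shows "minimal_automaton canonical_automaton"
  unfolding minimal_canonical_iff
proof (intro ballI impI)
  have sub: "small_inversions u \<subseteq> small_inversions w"
    if u: "u \<in> carrier G" and w: "w \<in> carrier G" and eq: "\<forall>xs. readable u xs \<longleftrightarrow> readable w xs" for u w
  proof
    fix b assume b: "b \<in> small_inversions u"
    then have b': "b \<in> inversions u" "b \<in> small_roots" by (auto simp: small_inversions_def)
    show "b \<in> small_inversions w"
    proof (rule ccontr)
      assume "b \<notin> small_inversions w"
      then have "b \<notin> inversions w" using b' by (simp add: small_inversions_def)
      then obtain x where x: "x \<in> carrier G" "inversions x \<inter> inversions w = {}" "b \<in> inversions x"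
        using spherical_complement[of b w] b' assms w by blast
      obtain xs where "readable \<one> xs" "word_prod G xs = x"
        using readable_word_exists[OF x(1)] .
      then show False
        using eq readable_iff[OF u, of xs] readable_iff[OF w, of xs] x b' by blast
    qed
  qed
  fix u w assume "u \<in> carrier G" "w \<in> carrier G" "\<forall>xs. readable u xs \<longleftrightarrow> readable w xs"
  then show "small_inversions u = small_inversions w"
    using sub[of u w] sub[of w u] by blast
qed

section \<open>Induction on the depth of roots\<close>

lemma B_expansion:
  obtains F where "finite F" "F \<subseteq> S" "\<And>t. t \<in> S - F \<Longrightarrow> coord v t = 0"
    "\<And>u. B u v = (\<Sum>t\<in>F. coord v t * B u (\<alpha> t))"
proof -
  obtain F where F: "finite F" "F \<subseteq> S" "\<And>t. t \<in> S - F \<Longrightarrow> coord v t = 0"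
    "v = (\<Sum>t\<in>F. coord v t *\<^sub>R \<alpha> t)"
    by (rule coord_expansion) blast
  have "B u v = (\<Sum>t\<in>F. coord v t * B u (\<alpha> t))" for u
    by (subst F(4)) (simp add: B_sum_right B_simps)
  with F(1-3) show thesis by (rule that)
qed

lemma pos_root_coord_nonneg: "b \<in> pos_roots \<Longrightarrow> s \<in> S \<Longrightarrow> 0 \<le> coord b s"
  by (simp add: pos_roots_def simple_cone_iff)

text \<open>The value \<open>B b b\<close> = 1 is a combination of the numbers B(alpha_s, b) with
  nonnegative coefficients, so one of them is positive.\<close>

lemma pos_root_descent:
  assumes "b \<in> pos_roots"
  obtains s where "s \<in> S" "0 < B (\<alpha> s) b"
proof -
  obtain F where F: "F \<subseteq> S" "\<And>u. B u b = (\<Sum>t\<in>F. coord b t * B u (\<alpha> t))"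
    by (rule B_expansion) blast
  have "\<exists>s\<in>S. 0 < B (\<alpha> s) b"
  proof (rule ccontr)
    assume "\<not> (\<exists>s\<in>S. 0 < B (\<alpha> s) b)"
    then have "B b (\<alpha> t) \<le> 0" if "t \<in> F" for t
      using that F(1) form_sym[of b "\<alpha> t"] by force
    then have "B b b \<le> 0"
      unfolding F(2) using pos_root_coord_nonneg[OF assms] F(1)
      by (intro sum_nonpos) (auto intro: mult_nonneg_nonpos)
    then show False using root_norm[OF pos_root_root[OF assms]] by simp
  qed
  then show thesis using that by blast
qed

section \<open>Reflections, dominance over simple roots, and growth of small roots\<close>

text \<open>A relation avoids choosing w with b = w(\<open>\<alpha> s\<close>), on which the
  expression of the reflection as a conjugate of s depends.\<close>

definition reflects :: "'g \<Rightarrow> 'v \<Rightarrow> bool" where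
  "reflects r b \<longleftrightarrow> r \<in> carrier G \<and> (\<forall>v. act r v = v - (2 * B b v) *\<^sub>R b)"

lemma reflects_conj:
  assumes "reflects r b" "w \<in> carrier G"
  shows "reflects (w \<otimes> r \<otimes> inv w) (act w b)"
proof -
  have "B (act w b) v = B b (act (inv w) v)" for v
    using B_act[of w b "act (inv w) v"] assms by simp
  then show ?thesis
    using assms by (simp add: reflects_def act_mult act_simps)
qed

lemma reflects_exists: "b \<in> roots \<Longrightarrow> \<exists>r. reflects r b"
proof (erule root_cases)
  fix w s assume *: "w \<in> carrier G" "s \<in> S" "b = act w (\<alpha> s)"
  have "reflects s (\<alpha> s)" using * by (simp add: reflects_def act_generator)
  then show "\<exists>r. reflects r b" using reflects_conj * by blast
qed

lemma reflects_inv: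
  assumes "reflects r b" "b \<in> roots"
  shows "reflects (inv r) b"
proof -
  have r: "r \<in> carrier G" using assms by (simp add: reflects_def)
  have "act r (v - (2 * B b v) *\<^sub>R b) = v" for v
  proof -
    have *: "act r u = u - (2 * B b u) *\<^sub>R b" for u
      using assms by (simp add: reflects_def)
    have "B b (v - (2 * B b v) *\<^sub>R b) = - B b v"
      using root_norm[OF assms(2)] by (simp add: B_simps)
    then show ?thesis by (simp add: *)
  qed
  then have "act (inv r) v = v - (2 * B b v) *\<^sub>R b" for v
    using r by (metis act_inv_left)
  then show ?thesis using r by (simp add: reflects_def)
qed

text \<open>The measure is the length of the reflection of a root, which decreases by two in each step.\<close>

lemma pos_root_induct [consumes 1, case_names simple step]:
  assumes "b \<in> pos_roots"
    and simple: "\<And>s. s \<in> S \<Longrightarrow> P (\<alpha> s)"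
    and step: "\<And>c s. c \<in> pos_roots \<Longrightarrow> P c \<Longrightarrow> s \<in> S \<Longrightarrow> B (\<alpha> s) c < 0 \<Longrightarrow> P (act s c)"
  shows "P b"
proof -
  obtain r where "reflects r b"
    using reflects_exists assms(1) pos_root_root by blast
  then show ?thesis
    using assms(1)
  proof (induction "card (inversions r)" arbitrary: r b rule: less_induct)
    case less
    show ?case
    proof (cases "b \<in> \<alpha> ` S")
      case True
      then show ?thesis using simple by blast
    next
      case False
      obtain s where s: "s \<in> S" "0 < B (\<alpha> s) b"
        using pos_root_descent less.prems by blast
      have r: "r \<in> carrier G" using less.prems by (simp add: reflects_def)
      define c where "c = act s b"
      have b: "b = act s c" using s by (simp add: c_def)
      have c: "c \<in> pos_roots"
        unfolding c_def using False s less.prems by (intro act_generator_pos_root) auto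
      have neg: "B (\<alpha> s) c < 0"
        using B_act[of s "\<alpha> s" b] s by (simp add: c_def act_simple B_simps)
      obtain t where t: "t \<in> S" "t \<noteq> s" "0 < coord b t"
        using root_coord_determined[OF less.prems(2) s(1)] False s pos_root_coord_nonneg[OF less.prems(2)]
        by (metis image_eqI order_less_le)
      have cbt: "coord c t = coord b t"
        using s t by (simp add: c_def act_generator coord_simple)
      have Bs: "B b (\<alpha> s) = B (\<alpha> s) b" by (rule form_sym)
      \<comment> \<open>Away from \<open>s\<close>, this image is a negative multiple of b, and one
        negative coordinate shows that the root is not positive. Thus s shortens r from the right;
        the same coordinate, after applying s, shows that it shortens again from the left.\<close>
      have "coord (act r (\<alpha> s)) t < 0"
        using less.prems s t Bs by (simp add: reflects_def coord_simple)
      then have 1: "act r (\<alpha> s) \<notin> pos_roots"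
        using pos_root_coord_nonneg t by force
      have "act (inv (r \<otimes> s)) (\<alpha> s) = act s (act (inv r) (\<alpha> s))"
        using r s by (simp add: inv_mult_group generator_inv act_mult)
      also have "act (inv r) (\<alpha> s) = \<alpha> s - (2 * B (\<alpha> s) b) *\<^sub>R b"
        using reflects_inv[OF less.prems(1)] less.prems(2) Bs by (simp add: reflects_def pos_root_root)
      also have "act s \<dots> = - \<alpha> s - (2 * B (\<alpha> s) b) *\<^sub>R c"
        using s by (simp add: act_simps act_simple c_def)
      finally have "coord (act (inv (r \<otimes> s)) (\<alpha> s)) t < 0"
        using s t cbt by (simp add: coord_simple)
      then have 2: "\<alpha> s \<in> inversions (r \<otimes> s)"
        using r s pos_root_coord_nonneg t by (force simp: inversions_iff simple_pos_root)
      have "card (inversions (s \<otimes> (r \<otimes> s))) < card (inversions r)"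
        using card_inversions_mult_descent[OF r s(1) 1] card_inversions_mult_left[OF _ s(1) 2] r s
        by simp
      moreover have "reflects (s \<otimes> (r \<otimes> s)) c"
        using reflects_conj[OF less.prems(1), of s] s r by (simp add: c_def generator_inv m_assoc)
      ultimately have "P c" using less.hyps c by blast
      then show ?thesis using step[OF c _ s(1) neg] b by simp
    qed
  qed
qed

text \<open>Suppose w inverts s(c) but not \<open>\<alpha> s\<close>. The roots obtained by
  reflecting repeatedly, starting from \<open>\<alpha> s\<close> and s(c), move ever further from
  \<open>\<alpha> s\<close>; w inverts all of them from s(c) on, so N(w) would be infinite.\<close>

lemma dominated_by_simple:
  assumes s: "s \<in> S" and c: "c \<in> pos_roots" and le: "B (\<alpha> s) c \<le> - 1"
  shows "dominated_by (\<alpha> s) (act s c)"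
  unfolding dominated_by_def
proof (intro ballI impI, rule ccontr)
  fix w assume w: "w \<in> carrier G" "act s c \<in> inversions w" "\<alpha> s \<notin> inversions w"
  define k where "k = - 2 * B (\<alpha> s) c"
  have k: "2 \<le> k" using le by (simp add: k_def)
  \<comment> \<open>The recursion looks back two places, hence pairs. The next root is the negative
    of the reflection of \<open>y n\<close> in \<open>y (Suc n)\<close>, and k is twice the constant
    form value of neighbours.\<close>
  define x where "x = rec_nat (\<alpha> s, act s c) (\<lambda>_ (u, v). (v, k *\<^sub>R v - u))"
  define y where "y n = fst (x n)" for n
  have y0: "y 0 = \<alpha> s" and y1: "y (Suc 0) = act s c"
    and yS: "y (Suc (Suc n)) = k *\<^sub>R y (Suc n) - y n" for n
    by (simp_all add: y_def x_def split_beta)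
  have d1: "y (Suc 0) - y 0 = c + (k - 1) *\<^sub>R \<alpha> s"
    using s by (simp add: y0 y1 act_generator k_def algebra_simps)
  have ydiff: "y (Suc (Suc n)) - y (Suc n) = (k - 2) *\<^sub>R y (Suc n) + (y (Suc n) - y n)" for n
    by (simp add: yS algebra_simps scaleR_2)
  have c_roots: "c \<in> roots" and s_roots: "\<alpha> s \<in> roots"
    using c s by (simp_all add: pos_root_root simple_root)
  have sc: "act s c \<in> pos_roots"
    using w(2) by (rule inversions_pos_roots)
  have By: "y n \<in> roots \<and> y (Suc n) \<in> roots \<and> B (y n) (y (Suc n)) = k / 2" for n
  proof (induction n)
    case 0
    show ?case using B_act[of s "\<alpha> s" c] s
      by (simp add: y0 y1 s_roots sc pos_root_root act_simple B_simps k_def)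
  next
    case (Suc n)
    obtain r where r: "reflects r (y (Suc n))"
      using reflects_exists Suc by blast
    have B': "B (y (Suc n)) (y n) = k / 2" using Suc form_sym by metis
    then have "y (Suc (Suc n)) = - act r (y n)"
      using r by (simp add: reflects_def yS)
    moreover have "- act r (y n) \<in> roots"
      using r Suc roots_uminus roots_act unfolding reflects_def by blast
    ultimately have "y (Suc (Suc n)) \<in> roots" by simp
    moreover have "B (y (Suc n)) (y (Suc (Suc n))) = k / 2"
      using B' Suc root_norm[of "y (Suc n)"] by (simp add: yS B_simps)
    ultimately show ?case using Suc by simp
  qed
  \<comment> \<open>The differences are tracked as well, since for k = 2 the roots grow only
    linearly. In \<open>ydiff\<close> the coefficients k - 2 and 1 are nonnegative, so positivity
    here, and negativity under the inverse of w below, pass on to the next term.\<close>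
  have pos: "y (Suc n) \<in> simple_cone \<and> y (Suc n) - y n \<in> simple_cone
      \<and> 1 \<le> coord (y (Suc n) - y n) s" for n
  proof (induction n)
    case 0
    have "0 \<le> coord c s" using pos_root_coord_nonneg c s by blast
    then show ?case
      unfolding d1 using sc c s k
      by (auto simp: y1 pos_root_cone coord_simple intro!: simple_cone_add simple_cone_scale simple_in_cone)
  next
    case (Suc n)
    have "y (Suc (Suc n)) - y (Suc n) \<in> simple_cone"
      unfolding ydiff using Suc k by (intro simple_cone_add simple_cone_scale) auto
    moreover have "0 \<le> (k - 2) * coord (y (Suc n)) s"
      using Suc k s by (simp add: simple_cone_iff)
    then have "1 \<le> coord (y (Suc (Suc n)) - y (Suc n)) s"
      unfolding ydiff using Suc by simp
    moreover have "y (Suc (Suc n)) = (y (Suc (Suc n)) - y (Suc n)) + y (Suc n)" by simp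
    ultimately show ?case using Suc simple_cone_add by metis
  qed
  have neg: "- act (inv w) (y (Suc n)) \<in> simple_cone \<and> - act (inv w) (y (Suc n) - y n) \<in> simple_cone" for n
  proof (induction n)
    case 0
    have 1: "- act (inv w) (act s c) \<in> simple_cone" "act (inv w) (\<alpha> s) \<in> simple_cone"
      using w s inversions_iff[OF w(1), of "\<alpha> s"]
      by (simp_all add: inversions_iff_neg[OF w(1), of "act s c"] pos_root_cone simple_pos_root)
    then have "act (inv w) (\<alpha> s) + - act (inv w) (act s c) \<in> simple_cone"
      by (intro simple_cone_add)
    then show ?case using 1 w by (simp add: y0 y1 act_simps)
  next
    case (Suc n)
    have "- act (inv w) (y (Suc (Suc n)) - y (Suc n)) =
        (k - 2) *\<^sub>R (- act (inv w) (y (Suc n))) + - act (inv w) (y (Suc n) - y n)"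
      unfolding ydiff using w by (simp add: act_simps)
    also have "\<dots> \<in> simple_cone"
      using Suc k by (intro simple_cone_add simple_cone_scale) auto
    finally have 2: "- act (inv w) (y (Suc (Suc n)) - y (Suc n)) \<in> simple_cone" .
    have "- act (inv w) (y (Suc (Suc n))) =
        - act (inv w) (y (Suc (Suc n)) - y (Suc n)) + - act (inv w) (y (Suc n))"
      using w by (simp add: act_simps)
    then show ?case using 2 Suc simple_cone_add by metis
  qed
  have "y (Suc n) \<in> inversions w" for n
  proof -
    have "- act (inv w) (y (Suc n)) \<in> roots"
      using By w by (simp add: roots_uminus roots_act)
    then show ?thesis
      using By[of n] pos[of n] neg[of n] w(1) by (simp add: inversions_iff_neg pos_roots_def)
  qed
  moreover have "strict_mono (\<lambda>n. coord (y (Suc n)) s)"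
    unfolding strict_mono_Suc_iff
  proof
    fix n
    have "1 \<le> coord (y (Suc (Suc n)) - y (Suc n)) s" using pos[of "Suc n"] by blast
    then show "coord (y (Suc n)) s < coord (y (Suc (Suc n))) s" by simp
  qed
  then have "inj (\<lambda>n. y (Suc n))"
    by (metis (mono_tags, lifting) injI strict_mono_eq)
  ultimately have "infinite (inversions w)"
    by (meson image_subsetI infinite_iff_countable_subset)
  then show False using finite_inversions w by blast
qed

text \<open>A form value at most -1 would make s(c) strictly dominate \<open>\<alpha> s\<close>. So
  only values above -1 remain, and smallness descends from s(c) to c by
  \<open>small_act_small\<close>.\<close>

lemma small_root_induct [consumes 1, case_names simple step]:
  assumes "b \<in> small_roots"
    and simple: "\<And>s. s \<in> S \<Longrightarrow> P (\<alpha> s)"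
    and step: "\<And>c s. c \<in> small_roots \<Longrightarrow> P c \<Longrightarrow> s \<in> S \<Longrightarrow>
      - 1 < B (\<alpha> s) c \<Longrightarrow> B (\<alpha> s) c < 0 \<Longrightarrow> P (act s c)"
  shows "P b"
proof -
  have "b \<in> pos_roots" using assms(1) by (rule small_roots_pos)
  then show ?thesis
    using assms(1)
  proof (induction rule: pos_root_induct)
    case (simple s)
    then show ?case using assms(2) by blast
  next
    case (step c s)
    have "act s c \<noteq> \<alpha> s"
    proof
      assume "act s c = \<alpha> s"
      then have "c = - \<alpha> s" using step by (metis act_gen_square act_simple)
      then show False using step pos_root_uminus simple_pos_root by blast
    qed
    then have gt: "- 1 < B (\<alpha> s) c"
      using dominated_by_simple[of s c] step simple_pos_root
      by (force simp: small_roots_def not_le[symmetric])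
    \<comment> \<open>The reflection in c is the witness for \<open>small_act_small\<close>: it
      inverts c, while \<open>\<alpha> s\<close> goes to itself plus a positive multiple of c,
      because the form value is negative.\<close>
    obtain r where r: "reflects r c"
      using reflects_exists step pos_root_root by blast
    have rc: "r \<in> carrier G" using r by (simp add: reflects_def)
    have i: "reflects (inv r) c"
      using reflects_inv r step pos_root_root by blast
    have Bc: "B c (\<alpha> s) = B (\<alpha> s) c" by (rule form_sym)
    have "act (inv r) (\<alpha> s) = \<alpha> s + (- 2 * B (\<alpha> s) c) *\<^sub>R c"
      using i Bc by (simp add: reflects_def)
    moreover have "\<alpha> s + (- 2 * B (\<alpha> s) c) *\<^sub>R c \<in> simple_cone"
      using step by (intro simple_cone_add simple_cone_scale simple_in_cone pos_root_cone) auto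
    ultimately have "act (inv r) (\<alpha> s) \<in> pos_roots"
      using rc step by (metis (no_types, lifting) IntI inv_closed pos_roots_def roots_act simple_root)
    then have "\<alpha> s \<notin> inversions r"
      using rc by (simp add: inversions_iff)
    moreover have "act (inv r) c = - c"
      using i root_norm[of c] step by (simp add: reflects_def pos_root_root scaleR_2)
    then have "c \<in> inversions r"
      using rc step by (simp add: inversions_iff_neg)
    ultimately have "c \<in> small_roots"
      using small_act_small[of s c r] step rc by blast
    then show ?case using assms(3)[of c s] step gt by blast
  qed
qed

text \<open>The gap comes from - cos(pi/3) = -1/2: two labels of at least 3 together already reach
  the threshold -1.\<close>

lemma simple_form_cases:
  assumes "s \<in> S" "t \<in> S" "s \<noteq> t"
  shows "m s t = 0 \<and> B (\<alpha> s) (\<alpha> t) \<le> - 1 \<or>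
    m s t = 2 \<and> B (\<alpha> s) (\<alpha> t) = 0 \<or>
    2 < m s t \<and> B (\<alpha> s) (\<alpha> t) \<le> - 1 / 2"
proof -
  consider "m s t = 0" | "m s t = 2" | "2 < m s t"
    using m_ge_2[OF assms] by linarith
  then show ?thesis
  proof cases
    case 1
    then show ?thesis using form_infinite assms by simp
  next
    case 2
    then show ?thesis using form_finite[OF assms] by simp
  next
    case 3
    then have "cos (pi / 3) \<le> cos (pi / real (m s t))"
      by (intro cos_monotone_0_pi_le) (auto simp: field_simps)
    then show ?thesis using form_finite[OF assms] 3 by (simp add: cos_60)
  qed
qed

lemma simple_form_nonpos: "s \<in> S \<Longrightarrow> t \<in> S \<Longrightarrow> s \<noteq> t \<Longrightarrow> B (\<alpha> s) (\<alpha> t) \<le> 0"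
  using simple_form_cases[of s t] by auto

text \<open>
  When the coordinate at \<open>s\<close> becomes positive in a step \<open>c \<mapsto> s(c)\<close>, every nonzero summand of
  \<open>- 2 B (\<alpha> s) c = (\<Sum>t. coord c t * (- 2 B (\<alpha> s) (\<alpha> t)))\<close> is at least \<open>1\<close>.
\<close>

lemma pos_root_coord_ge_1:
  assumes "b \<in> pos_roots" "t \<in> S"
  shows "coord b t = 0 \<or> 1 \<le> coord b t"
proof -
  from assms(1) have "\<forall>t\<in>S. coord b t = 0 \<or> 1 \<le> coord b t"
  proof (induction rule: pos_root_induct)
    case (simple s)
    then show ?case by (simp add: coord_simple)
  next
    case (step c s)
    have *: "B (\<alpha> s) c \<le> - 1 / 2" if "coord c s = 0"
    proof -
      obtain F where F: "finite F" "F \<subseteq> S" "\<And>u. B u c = (\<Sum>t\<in>F. coord c t * B u (\<alpha> t))"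
        by (rule B_expansion) blast
      let ?f = "\<lambda>t. coord c t * B (\<alpha> s) (\<alpha> t)"
      have le: "?f t \<le> 0" if "t \<in> F" for t
        using that F(2) step simple_form_nonpos[of s t] pos_root_coord_nonneg[of c t] \<open>coord c s = 0\<close>
        by (cases "t = s") (auto intro: mult_nonneg_nonpos)
      have "\<exists>t\<in>F. ?f t < 0"
      proof (rule ccontr)
        assume "\<not> (\<exists>t\<in>F. ?f t < 0)"
        then have "0 \<le> B (\<alpha> s) c" unfolding F(3) by (intro sum_nonneg) force
        then show False using step by simp
      qed
      then obtain t where t: "t \<in> F" "?f t < 0" by blast
      then have ts: "t \<in> S" "t \<noteq> s" "coord c t \<noteq> 0" "B (\<alpha> s) (\<alpha> t) \<noteq> 0"
        using F(2) that by auto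
      then have "1 \<le> coord c t" "B (\<alpha> s) (\<alpha> t) \<le> - 1 / 2"
        using step simple_form_cases[of s t] by auto
      then have "?f t \<le> 1 * B (\<alpha> s) (\<alpha> t)" by (intro mult_right_mono_neg) auto
      moreover have "B (\<alpha> s) c = ?f t + sum ?f (F - {t})"
        unfolding F(3) using F(1) t(1) by (rule sum.remove)
      moreover have "sum ?f (F - {t}) \<le> 0" using le by (intro sum_nonpos) auto
      ultimately show ?thesis using \<open>B (\<alpha> s) (\<alpha> t) \<le> - 1 / 2\<close> by linarith
    qed
    show ?case
    proof
      fix t assume t: "t \<in> S"
      show "coord (act s c) t = 0 \<or> 1 \<le> coord (act s c) t"
      proof (cases "t = s")
        case True
        have "coord (act s c) s = coord c s - 2 * B (\<alpha> s) c"
          using step by (simp add: act_generator coord_simple)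
        then show ?thesis
          using True step * by (cases "coord c s = 0") force+
      next
        case False
        then show ?thesis using step t by (simp add: act_generator coord_simple)
      qed
    qed
  qed
  then show ?thesis using assms(2) by blast
qed

section \<open>Small roots of rank two\<close>

text \<open>By \<open>H\<close>, a generator g outside a finite pair is orthogonal to both simple
  roots or reaches -1 already when both coordinates are 1. Coordinates being at least 1, a root that
  involves both members of the pair cannot grow by g and stay small.\<close>

lemma small_spherical_rank_two:
  assumes H: "\<And>a b g. a \<in> S \<Longrightarrow> b \<in> S \<Longrightarrow> g \<in> S \<Longrightarrow> a \<noteq> b \<Longrightarrow> g \<noteq> a \<Longrightarrow> g \<noteq> b \<Longrightarrow> m a b \<noteq> 0 \<Longrightarrow>
    B (\<alpha> g) (\<alpha> a) + B (\<alpha> g) (\<alpha> b) \<le> - 1 \<or> B (\<alpha> g) (\<alpha> a) = 0 \<and> B (\<alpha> g) (\<alpha> b) = 0"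
  shows "small_roots \<subseteq> spherical_roots"
proof
  fix c assume c: "c \<in> small_roots"
  \<comment> \<open>The case a = b is allowed and covers simple roots, as \<open>m a a\<close> =
    1.\<close>
  let ?P = "\<lambda>c a b. a \<in> S \<and> b \<in> S \<and> m a b \<noteq> 0 \<and> (\<forall>t\<in>S - {a, b}. coord c t = 0)"
  have "\<exists>a b. ?P c a b"
    using c
  proof (induction rule: small_root_induct)
    case (simple s)
    then show ?case
      using m_eq_1_iff[of s s] by (intro exI[of _ s]) (auto simp: coord_simple)
  next
    case (step c g)
    then obtain a b where ab: "?P c a b" by blast
    have pos: "c \<in> pos_roots" using step by (simp add: small_roots_pos)
    have coord_eq: "coord (act g c) t = coord c t" if "t \<in> S - {g}" for t
      using that step by (auto simp: act_generator coord_simple)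
    \<comment> \<open>A root living on one generator d may pick g as its partner: an infinite label
      between them would make the form value at most -1.\<close>
    have single: "\<exists>a b. ?P (act g c) a b" if d: "d \<in> S" "d \<noteq> g" "\<forall>t\<in>S - {d}. coord c t = 0" for d
    proof -
      have "c = coord c d *\<^sub>R \<alpha> d"
        using d by (intro coord_eqI) (auto simp: coord_simple)
      then have Bc: "B (\<alpha> g) c = coord c d * B (\<alpha> g) (\<alpha> d)"
        by (metis bilinear_rmul[OF form_bilinear] real_scaleR_def)
      have "m d g \<noteq> 0"
      proof
        assume "m d g = 0"
        then have "B (\<alpha> g) (\<alpha> d) \<le> - 1"
          using form_infinite[of g d] step d m_sym[of g d] by simp
        moreover have "1 \<le> coord c d"
          using pos_root_coord_ge_1[OF pos d(1)] Bc step by auto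
        ultimately have "coord c d * B (\<alpha> g) (\<alpha> d) \<le> 1 * B (\<alpha> g) (\<alpha> d)"
          by (intro mult_right_mono_neg) auto
        then show False using Bc step \<open>B (\<alpha> g) (\<alpha> d) \<le> - 1\<close> by linarith
      qed
      then have "?P (act g c) d g" using d step coord_eq by auto
      then show ?thesis by blast
    qed
    consider "g = a \<or> g = b" | "g \<noteq> a" "g \<noteq> b" "a = b \<or> coord c b = 0" | "g \<noteq> a" "g \<noteq> b" "coord c a = 0"
      | "g \<noteq> a" "g \<noteq> b" "a \<noteq> b" "coord c a \<noteq> 0" "coord c b \<noteq> 0" by blast
    then show ?case
    proof cases
      case 1
      then have "coord (act g c) t = 0" if "t \<in> S - {a, b}" for t
        using that coord_eq[of t] ab by auto
      then have "?P (act g c) a b" using ab by blast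
      then show ?thesis by blast
    next
      case 2
      then show ?thesis using ab by (intro single[of a]) auto
    next
      case 3
      then show ?thesis using ab by (intro single[of b]) auto
    next
      case 4
      have "c = coord c a *\<^sub>R \<alpha> a + coord c b *\<^sub>R \<alpha> b"
        using ab 4 by (intro coord_eqI) (auto simp: coord_simple)
      then have Bc: "B (\<alpha> g) c = coord c a * B (\<alpha> g) (\<alpha> a) + coord c b * B (\<alpha> g) (\<alpha> b)"
        by (metis bilinear_rmul[OF form_bilinear] bilinear_radd[OF form_bilinear] real_scaleR_def)
      have "coord c a * B (\<alpha> g) (\<alpha> a) \<le> 1 * B (\<alpha> g) (\<alpha> a)" "coord c b * B (\<alpha> g) (\<alpha> b) \<le> 1 * B (\<alpha> g) (\<alpha> b)"
        using pos_root_coord_ge_1[OF pos] ab 4 step simple_form_nonpos[of g]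
        by (auto intro!: mult_right_mono_neg simp del: mult_1)
      then show ?thesis using H[of a b g] ab 4 step Bc by auto
    qed
  qed
  then obtain a b where ab: "?P c a b" by blast
  have "support c \<subseteq> {a, b}" using ab by (force simp: support_iff)
  then show "c \<in> spherical_roots"
    using spherical_rootI[OF small_roots_pos[OF c]] finite_dihedral[of a b] ab by blast
qed

text \<open>Off the diagonal the form values are 0 or at most -1, so a single nonorthogonal
  neighbour suffices.\<close>

lemma right_angled_small_spherical:
  assumes right_angled
  shows "small_roots \<subseteq> spherical_roots"
proof (rule small_spherical_rank_two)
  fix a b g assume "a \<in> S" "b \<in> S" "g \<in> S" "g \<noteq> a" "g \<noteq> b"
  then show "B (\<alpha> g) (\<alpha> a) + B (\<alpha> g) (\<alpha> b) \<le> - 1 \<or> B (\<alpha> g) (\<alpha> a) = 0 \<and> B (\<alpha> g) (\<alpha> b) = 0"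
    using simple_form_cases[of g a] simple_form_cases[of g b] assms
    unfolding right_angled_def by fastforce
qed

text \<open>Both form values are at most -1/2.\<close>

lemma complete_small_spherical:
  assumes complete_coxeter_graph
  shows "small_roots \<subseteq> spherical_roots"
proof (rule small_spherical_rank_two)
  fix a b g assume "a \<in> S" "b \<in> S" "g \<in> S" "g \<noteq> a" "g \<noteq> b"
  then show "B (\<alpha> g) (\<alpha> a) + B (\<alpha> g) (\<alpha> b) \<le> - 1 \<or> B (\<alpha> g) (\<alpha> a) = 0 \<and> B (\<alpha> g) (\<alpha> b) = 0"
    using simple_form_cases[of g a] simple_form_cases[of g b] assms
    unfolding complete_coxeter_graph_def by fastforce
qed

lemma finite_small_spherical:
  assumes "finite (carrier G)"
  shows "small_roots \<subseteq> spherical_roots"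
  using spherical_rootI[OF small_roots_pos support_subset] assms by (auto simp: generators_generate)

section \<open>Rank three\<close>

text \<open>Only {s, u} and {t, u} can have a finite label. The generator outside such a pair is t
  or s, and in either case the infinite edge between s and t already contributes -1.\<close>

lemma rank_three_infinite_label:
  assumes S: "S = {s, t, u}" and ne: "s \<noteq> t" "t \<noteq> u" "s \<noteq> u" and "m s u = 2" "m s t = 0"
  shows "small_roots \<subseteq> spherical_roots"
proof (rule small_spherical_rank_two)
  have *: "s \<in> S" "t \<in> S" "u \<in> S" using S by auto
  have "B (\<alpha> s) (\<alpha> t) \<le> - 1" "B (\<alpha> s) (\<alpha> u) = 0" "B (\<alpha> t) (\<alpha> u) \<le> 0"
    using simple_form_cases[of s t] simple_form_cases[of s u] simple_form_nonpos[of t u] assms * by auto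
  note form = this this[unfolded form_sym[of "\<alpha> s"] form_sym[of "\<alpha> t" "\<alpha> u"]]
  fix a b g assume "a \<in> S" "b \<in> S" "g \<in> S" "a \<noteq> b" "g \<noteq> a" "g \<noteq> b" "m a b \<noteq> 0"
  then have "g = t \<and> (a = s \<and> b = u \<or> a = u \<and> b = s) \<or> g = s \<and> (a = t \<and> b = u \<or> a = u \<and> b = t)"
    using assms m_sym[of s t] * by (auto simp: S)
  then show "B (\<alpha> g) (\<alpha> a) + B (\<alpha> g) (\<alpha> b) \<le> - 1 \<or> B (\<alpha> g) (\<alpha> a) = 0 \<and> B (\<alpha> g) (\<alpha> b) = 0"
    using form by auto
qed

text \<open>Such an element would be the longest one: its inverse makes every simple root negative,
  hence every positive root, so there are only finitely many positive roots.\<close>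

lemma finite_if_all_descents:
  assumes w: "w \<in> carrier G" and all: "\<And>s. s \<in> S \<Longrightarrow> \<alpha> s \<in> inversions w"
  shows "finite (carrier G)"
proof -
  have "b \<in> inversions w" if b: "b \<in> pos_roots" for b
  proof -
    obtain F where F: "finite F" "F \<subseteq> S" "b = (\<Sum>s\<in>F. coord b s *\<^sub>R \<alpha> s)"
      by (rule coord_expansion)
    have "- act (inv w) b = - act (inv w) (\<Sum>s\<in>F. coord b s *\<^sub>R \<alpha> s)"
      using F(3) by simp
    also have "\<dots> = (\<Sum>s\<in>F. coord b s *\<^sub>R (- act (inv w) (\<alpha> s)))"
      using w by (simp add: act_sum act_simps sum_negf)
    also have "\<dots> \<in> simple_cone"
      using F(2) all w b pos_root_coord_nonneg
      by (intro simple_cone_sum simple_cone_scale) (auto simp: inversions_iff_neg pos_root_cone subset_iff)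
    finally have "- act (inv w) b \<in> simple_cone" .
    then show ?thesis
      using w b by (simp add: inversions_iff_neg pos_roots_def roots_uminus roots_act)
  qed
  then have "pos_roots \<subseteq> inversions w" by blast
  then have "finite pos_roots" using finite_inversions[OF w] by (rule finite_subset)
  moreover have "inversions ` carrier G \<subseteq> Pow pos_roots" by (auto dest: inversions_pos_roots)
  ultimately show ?thesis
    using inversions_inj by (meson finite_Pow_iff inj_on_finite)
qed

text \<open>As u fixes \<open>\<alpha> s\<close>, applying u would make s(\<open>\<alpha> t\<close>)
  dominate \<open>\<alpha> s\<close>. But that root has support in a finite dihedral subgroup and is
  therefore small.\<close>

lemma not_dominated_by_simple_product:
  assumes stu: "s \<in> S" "t \<in> S" "u \<in> S" "s \<noteq> t" "t \<noteq> u" "s \<noteq> u" and "m s u = 2" "m s t \<noteq> 0"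
  shows "\<not> dominated_by (\<alpha> s) (act u (act s (\<alpha> t)))"
proof
  assume d: "dominated_by (\<alpha> s) (act u (act s (\<alpha> t)))"
  let ?d = "act s (\<alpha> t)"
  have ne: "\<alpha> s \<noteq> \<alpha> u" "\<alpha> t \<noteq> \<alpha> s"
    using simple_roots_inj stu by (auto dest: inj_onD)
  have us: "act u (\<alpha> s) = \<alpha> s"
    using simple_form_cases[of s u] assms form_sym[of "\<alpha> u" "\<alpha> s"] by (simp add: act_generator)
  have pos: "?d \<in> pos_roots"
    using act_generator_pos_root stu simple_pos_root ne by blast
  have "support ?d \<subseteq> {s, t}"
    using stu by (auto simp: support_iff act_generator coord_simple split: if_splits)
  then have small: "?d \<in> small_roots"
    using spherical_rootI[OF pos] finite_dihedral[of s t] assms spherical_roots_small by blast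
  have dne: "?d \<noteq> \<alpha> s"
  proof
    assume "?d = \<alpha> s"
    then have "coord ?d t = coord (\<alpha> s) t" by simp
    then show False using stu by (simp add: act_generator coord_simple)
  qed
  have "?d \<noteq> \<alpha> u"
  proof
    assume e: "?d = \<alpha> u"
    have "act s (\<alpha> u) = \<alpha> u"
      using simple_form_cases[of s u] assms by (simp add: act_generator)
    then have "\<alpha> t = \<alpha> u" using e stu by (metis act_gen_square)
    then show False using simple_roots_inj stu by (auto dest: inj_onD)
  qed
  then have "dominated_by (act u (\<alpha> s)) (act u (act u ?d))"
    using dominated_by_act[OF simple_pos_root[OF stu(1)] ne(1) stu(3) act_generator_pos_root[OF stu(3) pos] d]
    by simp
  then have "dominated_by (\<alpha> s) ?d" using us stu by simp
  then show False
    using small dne[symmetric] simple_pos_root[OF stu(1)] unfolding small_roots_def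
    by (metis (mono_tags, lifting) mem_Collect_eq)
qed

text \<open>
  If \<open>s\<close> and \<open>u\<close> commute, then an inversion set that contains the root \<open>su(\<alpha> t)\<close> but neither
  \<open>\<alpha> s\<close> nor \<open>\<alpha> u\<close> would, after multiplication by \<open>su\<close>, contain all simple roots, which is impossible
  in an infinite group. Hence the states of \<open>su\<close> and \<open>sut\<close> are equivalent; they differ because the
  root is small.
\<close>

lemma rank_three_not_minimal:
  assumes S: "S = {s, t, u}" and ne: "s \<noteq> t" "t \<noteq> u" "s \<noteq> u" and su: "m s u = 2"
    and fin: "m s t \<noteq> 0" "m t u \<noteq> 0" and inf: "infinite (carrier G)"
  shows "\<not> minimal_automaton canonical_automaton"
proof -
  have S': "s \<in> S" "t \<in> S" "u \<in> S" using S by auto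
  have ac: "s \<otimes> u \<in> carrier G" using S' by simp
  have B0: "B (\<alpha> s) (\<alpha> u) = 0" "B (\<alpha> u) (\<alpha> s) = 0"
    using simple_form_cases[of s u] S' ne su form_sym[of "\<alpha> u" "\<alpha> s"] by auto
  then have fixed: "act s (\<alpha> u) = \<alpha> u" "act u (\<alpha> s) = \<alpha> s"
    using S' by (simp_all add: act_generator)
  have comm: "act s (act u v) = act u (act s v)" for v
    using S' B0 by (simp add: act_generator B_simps)
  define b where "b = act (s \<otimes> u) (\<alpha> t)"
  have b1: "b = act s (act u (\<alpha> t))" and b2: "b = act u (act s (\<alpha> t))"
    using S' comm by (simp_all add: b_def act_mult)
  have "coord b t = 1" using S' ne by (simp add: b1 act_generator coord_simple)
  then have b: "b \<in> pos_roots"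
    using S' by (intro pos_rootI_coord[of _ t]) (auto simp: b_def roots_act simple_root)
  have neu: "\<alpha> s \<noteq> \<alpha> u" using simple_roots_inj S' ne by (auto dest: inj_onD)
  have N: "inversions (s \<otimes> u) = {\<alpha> s, \<alpha> u}"
    using inversions_mult_generator_left[of u s] S' neu fixed by (simp add: inversions_generator)
  note Nt = inversions_mult_generator_right[OF ac S'(2), folded b_def, OF b]
  have small: "b \<in> small_roots"
  proof (rule ccontr)
    assume "b \<notin> small_roots"
    then obtain a where a: "a \<noteq> b" "dominated_by a b" using b by (auto simp: small_roots_def)
    have "b \<in> inversions (s \<otimes> u \<otimes> t)" using Nt by simp
    \<comment> \<open>Testing dominance on sut leaves just two candidates, since N(sut) consists of
      \<open>\<alpha> s\<close>, \<open>\<alpha> u\<close> and b.\<close>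
    then have "a \<in> inversions (s \<otimes> u \<otimes> t)" using a(2) S' by (simp add: dominated_by_def)
    then consider "a = \<alpha> s" | "a = \<alpha> u" using a(1) Nt N by auto
    then show False
    proof cases
      case 1
      then show False
        using a(2) not_dominated_by_simple_product[of s t u] S' ne su fin b2 by simp
    next
      case 2
      then show False
        using a(2) not_dominated_by_simple_product[of u t s] S' ne su fin b1 m_sym[of s u] m_sym[of t u] by auto
    qed
  qed
  have key: "b \<notin> inversions x"
    if x: "x \<in> carrier G" and disj: "\<alpha> s \<notin> inversions x" "\<alpha> u \<notin> inversions x" for x
  proof
    assume bx: "b \<in> inversions x"
    let ?y = "s \<otimes> u \<otimes> x"
    have y: "act (inv ?y) v = act (inv x) (act u (act s v))" for v
      using x S' by (simp add: inv_mult_group generator_inv act_mult)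
    have yc: "?y \<in> carrier G" using x S' by simp
    have "act (inv x) (\<alpha> s) \<in> pos_roots" "act (inv x) (\<alpha> u) \<in> pos_roots" "- act (inv x) b \<in> pos_roots"
      using disj x S' inversions_iff_neg[OF x, of b] bx by (simp_all add: inversions_iff simple_pos_root)
    then have "\<alpha> s \<in> inversions ?y" "\<alpha> u \<in> inversions ?y" "\<alpha> t \<in> inversions ?y"
      using x S' fixed
      by (simp_all add: inversions_iff_neg[OF yc] y act_simple act_simps simple_pos_root flip: b2)
    then have "finite (carrier G)"
      using finite_if_all_descents[of ?y] x S' by (auto simp: S)
    then show False using inf by simp
  qed
  have "readable (s \<otimes> u) xs \<longleftrightarrow> readable (s \<otimes> u \<otimes> t) xs" for xs
  proof (cases "readable \<one> xs")
    case True
    then have "word_prod G xs \<in> carrier G" by (simp add: readable_in_lists)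
    then show ?thesis
      using key[of "word_prod G xs"] readable_iff[of "s \<otimes> u" xs] readable_iff[of "s \<otimes> u \<otimes> t" xs] S' Nt N
      by auto
  qed (use readable_iff[of "s \<otimes> u" xs] readable_iff[of "s \<otimes> u \<otimes> t" xs] S' in simp)
  moreover have "small_inversions (s \<otimes> u) \<noteq> small_inversions (s \<otimes> u \<otimes> t)"
    using Nt small by (auto simp: small_inversions_def)
  ultimately show ?thesis
    unfolding minimal_canonical_iff using S' by (meson m_closed generator_closed)
qed

lemma rank_three:
  assumes "card S = 3" "minimal_automaton canonical_automaton"
  shows "small_roots \<subseteq> spherical_roots"
proof (cases "finite (carrier G) \<or> complete_coxeter_graph")
  case True
  then show ?thesis using finite_small_spherical complete_small_spherical by blast
next
  case False
  then obtain s u where su: "s \<in> S" "u \<in> S" "s \<noteq> u" "m s u \<noteq> 0" "\<not> 2 < m s u"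
    by (auto simp: complete_coxeter_graph_def)
  then have m2: "m s u = 2" using m_ge_2[of s u] by linarith
  have "card (S - {s, u}) = 1" using assms(1) su by (simp add: card_Diff_subset)
  then obtain t where "S - {s, u} = {t}" by (rule card_1_singletonE)
  then have t: "S = {s, t, u}" "s \<noteq> t" "t \<noteq> u" using su by auto
  then consider "m s t = 0" | "m t u = 0"
    using rank_three_not_minimal[of s t u] su m2 assms(2) False by blast
  then show ?thesis
  proof cases
    case 1
    then show ?thesis using rank_three_infinite_label[OF t su(3) m2] by simp
  next
    case 2
    have "t \<in> S" "S = {u, t, s}" using t by auto
    moreover have "m u s = 2" "m u t = 0"
      using 2 m2 m_sym[of s u] m_sym[of t u] su \<open>t \<in> S\<close> by simp_all
    ultimately show ?thesis
      using rank_three_infinite_label[of u t s] t(2,3) su(3) by blast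
  qed
qed

section \<open>Affine type A\<close>

lemma mod_eq_close:
  fixes a b n :: nat
  assumes "a mod n = b mod n" "a < b + n" "b < a + n"
  shows "a = b"
proof (cases "a \<le> b")
  case True
  then have "n dvd b - a" using assms(1) by (metis mod_eq_dvd_iff_nat)
  then show ?thesis using assms(3) True dvd_imp_le[of n "b - a"] by fastforce
next
  case False
  then have "n dvd a - b" using assms(1) by (metis mod_eq_dvd_iff_nat nat_le_linear)
  then show ?thesis using assms(2) False dvd_imp_le[of n "a - b"] by fastforce
qed

text \<open>
  Writing \<open>p k\<close> for the sum of the first \<open>k\<close> simple roots along the cycle, the reflection in the
  simple root \<open>l\<close> interchanges \<open>p l\<close> and \<open>p (l + 1)\<close> modulo \<open>n\<close>, up to a constant that cancels in
  differences \<open>p y - p x\<close>. The small roots are the differences with \<open>0 < y - x < n\<close>.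
\<close>

lemma affine_type_A_small_spherical:
  assumes affine_type_A
  shows "small_roots \<subseteq> spherical_roots"
proof -
  obtain n f where n: "3 \<le> n" and bij: "bij_betw f {..<n} S"
    and mf: "\<And>i j. i < n \<Longrightarrow> j < n \<Longrightarrow> i \<noteq> j \<Longrightarrow>
      m (f i) (f j) = (if j = Suc i mod n \<or> i = Suc j mod n then 3 else 2)"
    using assms unfolding affine_type_A_def by blast
  have fS: "f i \<in> S" if "i < n" for i using bij that by (auto simp: bij_betw_def)
  have finj: "f i = f j \<longleftrightarrow> i = j" if "i < n" "j < n" for i j
    using bij that by (auto simp: bij_betw_def inj_on_def)
  define g where "g i = f (i mod n)" for i
  have gS: "g i \<in> S" for i using fS n by (simp add: g_def)
  define p where "p k = (\<Sum>j\<in>{0..<k}. \<alpha> (g j))" for k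
  have pS: "p (Suc k) = p k + \<alpha> (g k)" for k by (simp add: p_def)
  have Suc_mod_inj: "Suc i mod n = Suc j mod n \<longleftrightarrow> i = j" if "i < n" "j < n" for i j
    using that by (auto simp: mod_Suc)
  have Suc_mod_ne: "Suc l mod n \<noteq> l" if "l < n" for l
    using that n by (auto simp: mod_Suc)
  \<comment> \<open>Up to the value at y = 0, this is twice the form of the simple root at l with
    \<open>p y\<close>. Subtracting \<open>D l y\<close> times that root moves y one place forward
    from the residue l and one place back from l + 1.\<close>
  define D where "D l y = (of_bool (y mod n = Suc l mod n) - of_bool (y mod n = l) :: real)" for l y
  have Bf: "2 * B (\<alpha> (f l)) (\<alpha> (f i)) =
      2 * of_bool (i = l) - of_bool (i = Suc l mod n) - of_bool (Suc i mod n = l)"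
    if "l < n" "i < n" for l i
  proof (cases "i = l")
    case True
    then show ?thesis using that Suc_mod_ne[of l] form_diag[OF fS] by auto
  next
    case False
    \<comment> \<open>As n is at least 3, the two neighbours of l are different and no index is
      counted twice.\<close>
    have "\<not> (i = Suc l mod n \<and> l = Suc i mod n)"
      using that n False by (auto simp: mod_Suc split: if_splits)
    then show ?thesis
      using form_finite[of "f l" "f i"] mf[of l i] finj[of l i] fS that False
      by (auto simp: cos_60)
  qed
  have Bp: "2 * B (\<alpha> (f l)) (p y) = D l y - D l 0" if l: "l < n" for l y
  proof (induction y)
    case 0
    show ?case by (simp add: p_def B_simps)
  next
    case (Suc y)
    let ?i = "y mod n"
    have i: "?i < n" using n by simp
    have e: "Suc y mod n = Suc ?i mod n" by (simp add: mod_Suc_eq)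
    have "D l (Suc y) - D l y = 2 * of_bool (?i = l) - of_bool (?i = Suc l mod n) - of_bool (Suc ?i mod n = l)"
      unfolding D_def e by (simp add: Suc_mod_inj[OF i l])
    then show ?case
      using Suc Bf[OF l i] by (simp add: pS B_simps g_def)
  qed
  have act_diff: "act (f l) (p y - p x) = (p y - D l y *\<^sub>R \<alpha> (f l)) - (p x - D l x *\<^sub>R \<alpha> (f l))"
    if l: "l < n" for l x y
  proof -
    have "2 * B (\<alpha> (f l)) (p y - p x) = D l y - D l x"
      using Bp[OF l, of x] Bp[OF l, of y] by (simp add: B_simps algebra_simps)
    then have "act (f l) (p y - p x) = (p y - p x) - (D l y - D l x) *\<^sub>R \<alpha> (f l)"
      using fS[OF l] by (simp add: act_generator)
    then show ?thesis by (simp add: algebra_simps)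
  qed
  have shift: "p (k + n) = p k + p n" for k
  proof (induction k)
    case (Suc k)
    have "g (k + n) = g k" by (simp add: g_def)
    then show ?case using Suc by (simp add: pS)
  qed (simp add: p_def)
  have p_diff: "p y - p x = (\<Sum>j\<in>{x..<y}. \<alpha> (g j))" if "x \<le> y" for x y
    using sum_diff_nat_ivl[of 0 x y "\<lambda>j. \<alpha> (g j)"] that by (simp add: p_def)
  have arc: "\<exists>x y. x < y \<and> y < x + n \<and> c = p y - p x" if "c \<in> small_roots" for c
    using that
  proof (induction rule: small_root_induct)
    case (simple s)
    then obtain l where "l < n" "s = f l" using bij by (auto simp: bij_betw_def)
    then have "\<alpha> s = p (Suc l) - p l" by (simp add: pS g_def)
    then show ?case using n by (intro exI[of _ l] exI[of _ "Suc l"]) auto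
  next
    case (step c s)
    then obtain l where l: "l < n" "s = f l" using bij by (auto simp: bij_betw_def)
    obtain x y where xy: "x < y" "y < x + n" "c = p y - p x" using step by blast
    have "2 * B (\<alpha> s) c = D l y - D l x"
      using Bp[OF l(1), of x] Bp[OF l(1), of y] unfolding l(2) xy(3)
      by (simp add: B_simps algebra_simps)
    \<comment> \<open>The value -2 occurs when l touches both ends of the arc and would close the
      cycle; it corresponds to the form value -1. So the arc grows at exactly one end.\<close>
    then have "- 2 < D l y - D l x" "D l y - D l x < 0" using step by auto
    then have "D l y - D l x = - 1 \<and> (y mod n = l \<and> x mod n \<noteq> Suc l mod n \<or> y mod n \<noteq> l \<and> x mod n = Suc l mod n)"
      using Suc_mod_ne[OF l(1)] by (auto simp: D_def of_bool_def split: if_splits)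
    then have d: "D l y - D l x = - 1" and
      dis: "y mod n = l \<and> x mod n \<noteq> Suc l mod n \<or> y mod n \<noteq> l \<and> x mod n = Suc l mod n" by auto
    have new: "act s c = p y - p x + \<alpha> s"
    proof -
      have "act s c = p y - p x - (D l y - D l x) *\<^sub>R \<alpha> s"
        using act_diff[OF l(1), of y x] unfolding l(2) xy(3) by (simp add: algebra_simps)
      then show ?thesis unfolding d by simp
    qed
    from dis show ?case
    proof
      assume 1: "y mod n = l \<and> x mod n \<noteq> Suc l mod n"
      then have "act s c = p (Suc y) - p x" using l new by (simp add: pS g_def)
      moreover have "Suc y \<noteq> x + n"
      proof
        assume "Suc y = x + n"
        then have "Suc y mod n = x mod n" by simp
        then show False using 1 by (metis mod_Suc_eq)
      qed
      ultimately show ?thesis using xy by (intro exI[of _ x] exI[of _ "Suc y"]) auto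
    next
      assume 2: "y mod n \<noteq> l \<and> x mod n = Suc l mod n"
      \<comment> \<open>The arc is to grow to x - 1, which is no natural number for x = 0; moving
        both ends up by n leaves the difference unchanged.\<close>
      define x' where "x' = x + n - 1"
      have x': "Suc x' = x + n" using n by (simp add: x'_def)
      have "Suc (x' mod n) mod n = Suc x' mod n" by (rule mod_Suc_eq)
      also have "\<dots> = Suc l mod n" using 2 x' by simp
      finally have "x' mod n = l" using Suc_mod_inj[of "x' mod n" l] l n by simp
      then have "p (x + n) = p x' + \<alpha> s" using l pS[of x'] x' by (simp add: g_def)
      moreover have "p y - p x = p (y + n) - p (x + n)" by (simp add: shift)
      ultimately have "act s c = p (y + n) - p x'" unfolding new by simp
      moreover have "y \<noteq> x'" using 2 \<open>x' mod n = l\<close> by auto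
      then have "y + n < x' + n" using xy x' by linarith
      ultimately show ?thesis using xy x' by (intro exI[of _ x'] exI[of _ "y + n"]) auto
    qed
  qed
  show ?thesis
  proof
    fix c assume c: "c \<in> small_roots"
    then obtain x y where xy: "x < y" "y < x + n" "c = p y - p x" using arc by blast
    let ?J = "g ` {x..<y}"
    have "coord c s = 0" if "s \<in> S - ?J" for s
      using that gS xy unfolding xy(3) p_diff[OF less_imp_le[OF xy(1)]] coord_sum
      by (intro sum.neutral) (auto simp: coord_simple)
    then have "support c \<subseteq> ?J" by (metis DiffI less_irrefl subsetI support_iff)
    moreover have "finite (generate G ?J)"
    proof (rule finite_generateI)
      \<comment> \<open>The differences form the root system of type A on the arc, together with 0.
        Each reflection of the arc permutes \<open>?Q\<close> up to a constant that cancels in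
        differences.\<close>
      let ?Q = "p ` {x..y}"
      let ?R = "(\<lambda>(u, v). u - v) ` (?Q \<times> ?Q)"
      show "?J \<subseteq> S" using gS by auto
      show "finite ?R" by simp
      show "\<alpha> s \<in> ?R" if s: "s \<in> ?J" for s
      proof -
        obtain j where "j \<in> {x..<y}" "s = g j" using s by blast
        then have "p (Suc j) \<in> ?Q" "p j \<in> ?Q" by auto
        moreover have "\<alpha> s = p (Suc j) - p j" using \<open>s = g j\<close> by (simp add: pS)
        ultimately show ?thesis by (intro image_eqI[of _ _ "(p (Suc j), p j)"]) auto
      qed
      show "act s v \<in> ?R" if s: "s \<in> ?J" and v: "v \<in> ?R" for s v
      proof -
        obtain k where k: "k \<in> {x..<y}" "s = g k" using s by blast
        obtain i j where ij: "i \<in> {x..y}" "j \<in> {x..y}" "v = p j - p i" using v by auto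
        define l where "l = k mod n"
        have l: "l < n" "s = f l" using n k by (simp_all add: l_def g_def)
        have Q: "p j - D l j *\<^sub>R \<alpha> (f l) \<in> ?Q" if j: "j \<in> {x..y}" for j
        proof -
          \<comment> \<open>The indices from x to y are at most n in number, so their residues are
            distinct and the reflection affects only k and \<open>Suc k\<close>.\<close>
          have 1: "j mod n = l \<longleftrightarrow> j = k"
            using mod_eq_close[of j n k] j k xy by (auto simp: l_def)
          have "Suc l mod n = Suc k mod n" by (simp add: l_def mod_Suc_eq)
          then have 2: "j mod n = Suc l mod n \<longleftrightarrow> j = Suc k"
            using mod_eq_close[of j n "Suc k"] j k xy by auto
          have "\<alpha> (f l) = \<alpha> (g k)" by (simp add: l_def g_def)
          have "p k \<in> ?Q" "p (Suc k) \<in> ?Q" "p j \<in> ?Q" using j k by auto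
          moreover have "p k + \<alpha> (f l) = p (Suc k)" using \<open>\<alpha> (f l) = \<alpha> (g k)\<close> by (simp add: pS)
          then have "p j - D l j *\<^sub>R \<alpha> (f l) = (if j = k then p (Suc k) else if j = Suc k then p k else p j)"
            unfolding D_def 1 2 by (auto simp: algebra_simps)
          ultimately show ?thesis by (simp split: if_split)
        qed
        have "act s v = (p j - D l j *\<^sub>R \<alpha> (f l)) - (p i - D l i *\<^sub>R \<alpha> (f l))"
          using act_diff[OF l(1)] l ij by simp
        then show ?thesis using Q[OF ij(1)] Q[OF ij(2)]
          by (intro image_eqI[of _ _ "(p j - D l j *\<^sub>R \<alpha> (f l), p i - D l i *\<^sub>R \<alpha> (f l))"] SigmaI) simp_all
      qed
    qed
    ultimately show "c \<in> spherical_roots"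
      using spherical_rootI[OF small_roots_pos[OF c]] by blast
  qed
qed

end

section \<open>Assembly of the five cases\<close>

theorem theorem1p5:
  fixes G :: "('g, 'b) monoid_scheme"
    and S :: "'g set"
    and B :: "'v::real_vector \<Rightarrow> 'v \<Rightarrow> real"
    and \<alpha> :: "'g \<Rightarrow> 'v"
    and act :: "'g \<Rightarrow> 'v \<Rightarrow> 'v"
  assumes "coxeter_system G S"
    and "finite S"
    and "coxeter_system.irreducible_system G S"
    and "geometric_representation G S B \<alpha> act"
  defines "\<Sigma> \<equiv> geometric_representation.small_roots G S \<alpha> act"
    and "\<Phi>sph \<equiv> geometric_representation.spherical_roots G S \<alpha> act"
    and "\<A>0 \<equiv> geometric_representation.canonical_automaton G S \<alpha> act"
  shows "(finite (carrier G) \<or>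
          coxeter_system.right_angled G S \<or>
          coxeter_system.complete_coxeter_graph G S \<or>
          coxeter_system.affine_type_A G S \<or>
          card S = 3
            \<longrightarrow> (minimal_automaton \<A>0 \<longleftrightarrow> \<Sigma> = \<Phi>sph)) \<and>
         (finite (carrier G) \<or>
          coxeter_system.right_angled G S \<or>
          coxeter_system.complete_coxeter_graph G S \<or>
          coxeter_system.affine_type_A G S
            \<longrightarrow> \<Sigma> = \<Phi>sph \<and> minimal_automaton \<A>0)"
proof -
  interpret geometric_representation G S B \<alpha> act by fact
  have eq: "small_roots = spherical_roots \<longleftrightarrow> small_roots \<subseteq> spherical_roots"
    using spherical_roots_small by blast
  have "small_roots \<subseteq> spherical_roots"
    if "finite (carrier G) \<or> right_angled \<or> complete_coxeter_graph \<or> affine_type_A"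
    using that finite_small_spherical right_angled_small_spherical complete_small_spherical
      affine_type_A_small_spherical by blast
  then show ?thesis
    unfolding \<Sigma>_def \<Phi>sph_def \<A>0_def eq
    using rank_three minimal_if_small_spherical by blast
qed

end
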